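(* Let $(J,g)$ be a Hermitian structure on a unimodular almost abelian Lie algebra $\mathfrak{g}$ of real dimension $2n$. The Bismut connection $\nabla^B$ of $(J,g)$ has (restricted) holonomy contained in $\mathrm{SU}(n)$ if and only if the Hermitian metric $g$ is balanced.
   Context: A (real, finite-dimensional) Lie algebra $\mathfrak{g}$ is almost abelian if it contains an abelian ideal of codimension one; it is unimodular if $\operatorname{tr}\operatorname{ad}_X=0$ for all $X$. A Hermitian structure $(J,g)$ on $\mathfrak{g}$ is an integrable complex structure $J$ together with an inner product $g$ with $g(J\cdot,J\cdot)=g$ (equivalently, the corresponding left-invariant Hermitian structure on the simply connected Lie group); its fundamental form is $\omega=g(J\cdot,\cdot)$. It is balanced if $d\omega^{n-1}=0$, $d$ being the Chevalley-Eilenberg differential. The Bismut connection $\nabla^B$ is defined by $g(\nabla^B_XY,Z)=g(\nabla^g_XY,Z)+\frac12\,d\omega(JX,JY,JZ)$, with $\nabla^g$ the Levi-Civita connection; it satisfies $\nabla^Bg=0$, $\nabla^BJ=0$, so its restricted holonomy group $\mathrm{Hol}^0(\nabla^B)$ is contained in $\mathrm{U}(n)$. The condition $\mathrm{Hol}^0(\nabla^B)\subseteq\mathrm{SU}(n)$ is equivalent to the vanishing of the Bismut-Ricci form $\rho^B(X,Y)=-\frac12\sum_{i=1}^{2n}g(R^B(X,Y)e_i,Je_i)$, where $R^B$ is the curvature of $\nabla^B$ and $\{e_i\}$ an orthonormal basis. *)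

theory Defs
  imports "HOL-Analysis.Analysis"
begin

text \<open>
  The Lie algebra is a finite-dimensional real vector space \<open>'a::euclidean_space\<close> with an
  arbitrary bracket \<open>br\<close>. The Hermitian metric \<open>g\<close> is an arbitrary inner product and is
  unrelated to the inner product that comes with the type class, which is used only to provide
  a topology and a basis.
\<close>

section \<open>Lie algebras\<close>

definition lie_bracket :: "('a::euclidean_space \<Rightarrow> 'a \<Rightarrow> 'a) \<Rightarrow> bool" where
  "lie_bracket br \<longleftrightarrow> bilinear br \<and> (\<forall>X. br X X = 0) \<and>
     (\<forall>X Y Z. br X (br Y Z) + br Y (br Z X) + br Z (br X Y) = 0)"

definition abelian_ideal :: "('a::euclidean_space \<Rightarrow> 'a \<Rightarrow> 'a) \<Rightarrow> 'a set \<Rightarrow> bool" where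
  "abelian_ideal br H \<longleftrightarrow> subspace H \<and> (\<forall>X. \<forall>Y\<in>H. br X Y \<in> H) \<and> (\<forall>X\<in>H. \<forall>Y\<in>H. br X Y = 0)"

definition almost_abelian :: "('a::euclidean_space \<Rightarrow> 'a \<Rightarrow> 'a) \<Rightarrow> bool" where
  "almost_abelian br \<longleftrightarrow> (\<exists>H. abelian_ideal br H \<and> dim H + 1 = DIM('a))"

definition endo_trace :: "('a::euclidean_space \<Rightarrow> 'a) \<Rightarrow> real" where
  "endo_trace f = (\<Sum>b\<in>Basis. f b \<bullet> b)"

definition unimodular :: "('a::euclidean_space \<Rightarrow> 'a \<Rightarrow> 'a) \<Rightarrow> bool" where
  "unimodular br \<longleftrightarrow> (\<forall>X. endo_trace (br X) = 0)"

section \<open>Hermitian structures\<close>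

definition inner_product :: "('a::euclidean_space \<Rightarrow> 'a \<Rightarrow> real) \<Rightarrow> bool" where
  "inner_product g \<longleftrightarrow> bilinear g \<and> (\<forall>X Y. g X Y = g Y X) \<and> (\<forall>X. X \<noteq> 0 \<longrightarrow> g X X > 0)"

definition integrable_complex_structure ::
    "('a::euclidean_space \<Rightarrow> 'a \<Rightarrow> 'a) \<Rightarrow> ('a \<Rightarrow> 'a) \<Rightarrow> bool" where
  "integrable_complex_structure br J \<longleftrightarrow> linear J \<and> (\<forall>X. J (J X) = - X) \<and>
     (\<forall>X Y. br (J X) (J Y) - J (br (J X) Y) - J (br X (J Y)) - br X Y = 0)"

definition hermitian_structure ::
    "('a::euclidean_space \<Rightarrow> 'a \<Rightarrow> 'a) \<Rightarrow> ('a \<Rightarrow> 'a) \<Rightarrow> ('a \<Rightarrow> 'a \<Rightarrow> real) \<Rightarrow> bool" where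
  "hermitian_structure br J g \<longleftrightarrow> integrable_complex_structure br J \<and> inner_product g \<and>
     (\<forall>X Y. g (J X) (J Y) = g X Y)"

section \<open>Forms and the balanced condition\<close>

text \<open>
  A \<open>k\<close>-form is represented by a function on lists of vectors, of which only the values on lists
  of length \<open>k\<close> matter.
\<close>

type_synonym 'a form = "'a list \<Rightarrow> real"

definition fundamental_form :: "('a \<Rightarrow> 'a) \<Rightarrow> ('a \<Rightarrow> 'a \<Rightarrow> real) \<Rightarrow> 'a form" where
  "fundamental_form J g Xs = g (J (Xs ! 0)) (Xs ! 1)"

text \<open>
  Chevalley-Eilenberg differential:
  \<open>d\<alpha>(X\<^sub>0, \<dots>, X\<^sub>k) = \<Sum>\<^sub>i\<^sub><\<^sub>j (-1)\<^sup>i\<^sup>+\<^sup>j \<alpha>([X\<^sub>i, X\<^sub>j], X\<^sub>0, \<dots>, X\<^sub>k)\<close> with \<open>X\<^sub>i\<close> and \<open>X\<^sub>j\<close> omitted from the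
  list on the right.
\<close>

definition ce_differential :: "('a \<Rightarrow> 'a \<Rightarrow> 'a) \<Rightarrow> 'a form \<Rightarrow> 'a form" where
  "ce_differential br \<alpha> Xs =
     (\<Sum>j<length Xs. \<Sum>i<j. (-1) ^ (i + j) * \<alpha> (br (Xs ! i) (Xs ! j) # nths Xs (- {i, j})))"

definition wedge :: "nat \<Rightarrow> nat \<Rightarrow> 'a form \<Rightarrow> 'a form \<Rightarrow> 'a form" where
  "wedge p q \<alpha> \<beta> Xs =
     (\<Sum>\<sigma> | \<sigma> permutes {..<p + q}. of_int (sign \<sigma>) *
        \<alpha> (map (\<lambda>i. Xs ! \<sigma> i) [0..<p]) * \<beta> (map (\<lambda>i. Xs ! \<sigma> i) [p..<p + q])) / (fact p * fact q)"

primrec two_form_power :: "'a form \<Rightarrow> nat \<Rightarrow> 'a form" where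
  "two_form_power \<omega> 0 = (\<lambda>_. 1)"
| "two_form_power \<omega> (Suc k) = wedge 2 (2 * k) \<omega> (two_form_power \<omega> k)"

text \<open>Here \<open>n\<close> is the complex dimension, so \<open>d\<omega>\<^sup>n\<^sup>-\<^sup>1\<close> is a form of degree \<open>2 n - 1\<close>.\<close>

definition balanced ::
    "nat \<Rightarrow> ('a \<Rightarrow> 'a \<Rightarrow> 'a) \<Rightarrow> ('a \<Rightarrow> 'a) \<Rightarrow> ('a \<Rightarrow> 'a \<Rightarrow> real) \<Rightarrow> bool" where
  "balanced n br J g \<longleftrightarrow> (\<forall>Xs. length Xs = 2 * n - 1 \<longrightarrow>
     ce_differential br (two_form_power (fundamental_form J g) (n - 1)) Xs = 0)"

section \<open>The Bismut connection\<close>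

text \<open>
  A left-invariant connection \<open>\<nabla>\<close> is represented by the map \<open>(X, Y) \<mapsto> \<nabla>\<^sub>X Y\<close> on left-invariant
  vector fields. Functions \<open>g(X, Y)\<close> of left-invariant fields are constant, so metric
  compatibility has no derivative term.
\<close>

definition levi_civita ::
    "('a::euclidean_space \<Rightarrow> 'a \<Rightarrow> 'a) \<Rightarrow> ('a \<Rightarrow> 'a \<Rightarrow> real) \<Rightarrow> 'a \<Rightarrow> 'a \<Rightarrow> 'a" where
  "levi_civita br g = (THE D. bilinear D \<and>
     (\<forall>X Y Z. g (D X Y) Z + g Y (D X Z) = 0) \<and> (\<forall>X Y. D X Y - D Y X = br X Y))"

definition bismut ::
    "('a::euclidean_space \<Rightarrow> 'a \<Rightarrow> 'a) \<Rightarrow> ('a \<Rightarrow> 'a) \<Rightarrow> ('a \<Rightarrow> 'a \<Rightarrow> real) \<Rightarrow> 'a \<Rightarrow> 'a \<Rightarrow> 'a" where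
  "bismut br J g X Y = (THE W. \<forall>Z. g W Z = g (levi_civita br g X Y) Z +
     1 / 2 * ce_differential br (fundamental_form J g) [J X, J Y, J Z])"

section \<open>Restricted holonomy\<close>

text \<open>
  Let \<open>G\<close> be a Lie group with Lie algebra \<open>('a, br)\<close>. A curve \<open>\<gamma>\<close> in \<open>G\<close> starting at the identity is
  represented by its left logarithmic derivative \<open>c = \<gamma>\<^sup>-\<^sup>1 \<gamma>'\<close>, which determines it. A map \<open>f\<close>
  from the square \<open>[0,1]\<^sup>2\<close> (coordinates \<open>s\<close>, \<open>t\<close>) to \<open>G\<close> with \<open>f(0,0)\<close> the identity is likewise
  determined by \<open>f\<^sup>-\<^sup>1 df = u dt + v ds\<close>, and since the square is simply connected, the pairs
  \<open>(u, v)\<close> that occur are exactly the solutions of the Maurer-Cartan equation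
  \<open>\<partial>\<^sub>s u - \<partial>\<^sub>t v = [u, v]\<close>.

  Such an \<open>f\<close> contracts the loop \<open>f(1, \<cdot>)\<close> to the identity relative to the base point iff
  \<open>f(0, \<cdot>)\<close>, \<open>f(\<cdot>, 0)\<close> and \<open>f(\<cdot>, 1)\<close> are constant, that is, \<open>u(0, \<cdot>) = 0\<close> and
  \<open>v(\<cdot>, 0) = v(\<cdot>, 1) = 0\<close>. This describes the null-homotopic \<open>C\<^sup>1\<close> loops at the identity without
  reference to \<open>G\<close>. Piecewise \<open>C\<^sup>1\<close> loops are covered as well, since they become \<open>C\<^sup>1\<close> after a
  reparametrization, which does not affect parallel transport.
\<close>

definition null_homotopic_loop ::
    "('a::euclidean_space \<Rightarrow> 'a \<Rightarrow> 'a) \<Rightarrow> (real \<Rightarrow> 'a) \<Rightarrow> bool" where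
  "null_homotopic_loop br c \<longleftrightarrow> (\<exists>u v u' v' :: real \<Rightarrow> real \<Rightarrow> 'a.
     (\<forall>h\<in>{u, v, u', v'}. continuous_on ({0..1} \<times> {0..1}) (\<lambda>(s, t). h s t)) \<and>
     (\<forall>s\<in>{0..1}. \<forall>t\<in>{0..1}.
        ((\<lambda>s. u s t) has_vector_derivative u' s t) (at s within {0..1}) \<and>
        ((\<lambda>t. v s t) has_vector_derivative v' s t) (at t within {0..1}) \<and>
        u' s t - v' s t = br (u s t) (v s t)) \<and>
     (\<forall>t\<in>{0..1}. u 0 t = 0 \<and> u 1 t = c t) \<and>
     (\<forall>s\<in>{0..1}. v s 0 = 0 \<and> v s 1 = 0))"

text \<open>
  In the left trivialization of the tangent bundle, a vector field \<open>Y\<close> along \<open>\<gamma>\<close> is parallel for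
  the left-invariant connection \<open>D\<close> iff \<open>Y' + D c Y = 0\<close>. Below, \<open>F t\<close> is the parallel transport
  along \<open>\<gamma>\<close> from \<open>\<gamma>(0)\<close> to \<open>\<gamma>(t)\<close>.
\<close>

definition parallel_transport ::
    "('a::euclidean_space \<Rightarrow> 'a \<Rightarrow> 'a) \<Rightarrow> (real \<Rightarrow> 'a) \<Rightarrow> (real \<Rightarrow> 'a \<Rightarrow> 'a) \<Rightarrow> bool" where
  "parallel_transport D c F \<longleftrightarrow> (\<forall>y. F 0 y = y \<and>
     (\<forall>t\<in>{0..1}. ((\<lambda>t. F t y) has_vector_derivative - D (c t) (F t y)) (at t within {0..1})))"

definition restricted_holonomy ::
    "('a::euclidean_space \<Rightarrow> 'a \<Rightarrow> 'a) \<Rightarrow> ('a \<Rightarrow> 'a \<Rightarrow> 'a) \<Rightarrow> ('a \<Rightarrow> 'a) set" where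
  "restricted_holonomy br D = {F 1 | c F. null_homotopic_loop br c \<and> parallel_transport D c F}"

section \<open>The special unitary group\<close>

definition SU :: "(complex^'n^'n) set" where
  "SU = {U. U ** map_matrix cnj (transpose U) = mat 1 \<and> det U = 1}"

definition unitary_frame ::
    "('a::euclidean_space \<Rightarrow> 'a) \<Rightarrow> ('a \<Rightarrow> 'a \<Rightarrow> real) \<Rightarrow> ('n::finite \<Rightarrow> 'a) \<Rightarrow> bool" where
  "unitary_frame J g e \<longleftrightarrow>
     (\<forall>i j. g (e i) (e j) = (if i = j then 1 else 0) \<and> g (e i) (J (e j)) = 0) \<and>
     span (range e \<union> range (J \<circ> e)) = UNIV"

text \<open>
  The matrix, with respect to \<open>e\<close>, of a \<open>J\<close>-linear endomorphism, where the complex scalar \<open>\<i>\<close>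
  acts as \<open>J\<close>: \<open>P (e j) = (\<Sum>i. (a i j + b i j J) (e i))\<close> has the entries \<open>a i j + \<i> b i j\<close>.
\<close>

definition frame_matrix ::
    "('a::euclidean_space \<Rightarrow> 'a) \<Rightarrow> ('a \<Rightarrow> 'a \<Rightarrow> real) \<Rightarrow> ('n::finite \<Rightarrow> 'a) \<Rightarrow> ('a \<Rightarrow> 'a) \<Rightarrow> complex^'n^'n"
  where "frame_matrix J g e P = (\<chi> i j. Complex (g (P (e j)) (e i)) (g (P (e j)) (J (e i))))"

definition special_unitary ::
    "('a::euclidean_space \<Rightarrow> 'a) \<Rightarrow> ('a \<Rightarrow> 'a \<Rightarrow> real) \<Rightarrow> ('n::finite \<Rightarrow> 'a) \<Rightarrow> ('a \<Rightarrow> 'a) set" where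
  "special_unitary J g e =
     {P. linear P \<and> (\<forall>X. P (J X) = J (P X)) \<and> frame_matrix J g e P \<in> SU}"

end

theory Submission
  imports Defs
begin

text \<open>
  Let \<open>\<xi>\<close> be a unit normal to the abelian ideal, so that the bracket is determined by \<open>B = [\<xi>, \<cdot>]\<close>,
  and let \<open>\<eta> = J \<xi>\<close>. Both conditions turn out to be equivalent to \<open>B \<eta> = 0\<close>.

  Along a curve with logarithmic derivative \<open>c\<close>, the complex determinant of the parallel transport is
  \<open>exp (- \<i> \<integral> \<tau> (c))\<close> with \<open>\<tau> (X) = \<Sum>\<^sub>i g (D\<^sub>X e\<^sub>i, J e\<^sub>i)\<close>. By the Maurer-Cartan equation the
  integral vanishes along all null-homotopic loops if \<open>\<tau>\<close> vanishes on brackets, and an explicit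
  family of loops shows the converse. Unimodularity gives
  \<open>\<tau> (X) = - tr (J ad\<^sub>X) / 2 - g (\<Sum>\<^sub>i [e\<^sub>i, J e\<^sub>i], X)\<close>, the sum being \<open>B \<eta>\<close>. As \<open>B\<close> maps the
  complement of \<open>\<xi>\<close> and \<open>\<eta>\<close> to the complement of \<open>\<eta>\<close>, by integrability, \<open>\<tau> (B \<eta>)\<close> equals
  \<open>- g (B \<eta>, \<eta>)\<^sup>2 / 2 - g (B \<eta>, B \<eta>)\<close>, which is negative unless \<open>B \<eta> = 0\<close>.

  On the other hand, contracting \<open>d \<omega>\<^sup>n\<^sup>-\<^sup>1\<close> with \<open>\<xi>\<close> gives, up to sign, the derivation induced by \<open>B\<close>
  applied to the restriction of \<open>\<omega>\<^sup>n\<^sup>-\<^sup>1\<close> to the ideal. This restriction has kernel \<open>\<eta>\<close> and is a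
  volume form on the complement, so the derivation kills it iff \<open>B \<eta> = 0\<close>, as \<open>tr B = 0\<close>.
\<close>

section \<open>Alternating forms on lists\<close>

text \<open>Linearity in the first slot and antisymmetry under adjacent swaps keep inductions over
  lists short; linearity in the other slots follows by moving an entry to the front. Only lists of
  length \<open>N\<close> are constrained.\<close>

definition alternating_form :: "nat \<Rightarrow> 'a::real_vector form \<Rightarrow> bool" where
  "alternating_form N f \<longleftrightarrow>
     (\<forall>ys. Suc (length ys) = N \<longrightarrow> linear (\<lambda>x. f (x # ys))) \<and>
     (\<forall>as x y bs. length as + length bs + 2 = N \<longrightarrow> f (as @ x # y # bs) = - f (as @ y # x # bs))"

lemma alternating_form_linear_Cons:
  "alternating_form N f \<Longrightarrow> Suc (length ys) = N \<Longrightarrow> linear (\<lambda>x. f (x # ys))"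
  by (simp add: alternating_form_def)

lemma alternating_form_swap:
  "alternating_form N f \<Longrightarrow> length as + length bs + 2 = N \<Longrightarrow> f (as @ x # y # bs) = - f (as @ y # x # bs)"
  unfolding alternating_form_def by blast

lemma alternating_form_Cons:
  fixes f :: "'a::real_vector form"
  assumes "alternating_form (Suc N) f"
  shows "alternating_form N (\<lambda>ys. f (x # ys))"
  unfolding alternating_form_def
proof (intro conjI allI impI)
  fix ys :: "'a list" assume l: "Suc (length ys) = N"
  have eq: "(\<lambda>z. f (x # z # ys)) = (\<lambda>z. - f (z # x # ys))"
    using alternating_form_swap[OF assms, of "[]" ys _ x] l by fastforce
  show "linear (\<lambda>z. f (x # z # ys))"
    unfolding eq using l by (intro linear_compose_neg alternating_form_linear_Cons[OF assms]) simp
next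
  fix as bs :: "'a list" and y z assume "length as + length bs + 2 = N"
  then show "f (x # as @ y # z # bs) = - f (x # as @ z # y # bs)"
    using alternating_form_swap[OF assms, of "x # as" bs y z] by simp
qed

text \<open>Each adjacent swap that brings \<open>x\<close> one place forward costs a sign; the
  induction peels off the head with \<open>alternating_form_Cons\<close>.\<close>

lemma alternating_form_move:
  assumes "alternating_form N f" and "length as + length bs + 1 = N"
  shows "f (as @ x # bs) = (-1) ^ length as * f (x # as @ bs)"
  using assms
proof (induction as arbitrary: N f)
  case (Cons a as)
  obtain M where M: "N = Suc M" using Cons.prems(2) by (cases N) auto
  have "f (a # as @ x # bs) = (-1) ^ length as * f (a # x # as @ bs)"
    using Cons.IH[OF alternating_form_Cons[OF Cons.prems(1)[unfolded M], of a]] Cons.prems(2) M by simp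
  also have "f (a # x # as @ bs) = - f (x # a # as @ bs)"
    using alternating_form_swap[OF Cons.prems(1), of "[]" "as @ bs" a x] Cons.prems(2) by simp
  finally show ?case by (simp only: append_Cons length_Cons power_Suc mult_minus_right mult_minus_left mult_1)
qed simp

lemma alternating_form_linear:
  assumes "alternating_form N f" and "length as + length bs + 1 = N"
  shows "linear (\<lambda>x. f (as @ x # bs))"
proof -
  have "linear (\<lambda>x. (-1) ^ length as *\<^sub>R f (x # as @ bs))"
    using assms by (intro linear_compose_scale_right alternating_form_linear_Cons[OF assms(1)]) simp
  then show ?thesis by (simp add: alternating_form_move[OF assms])
qed

text \<open>Moving slot \<open>j\<close> next to the head gives both sides the same factor
  \<open>(-1) ^ j\<close>, after which one adjacent swap remains. In this form a transposition
  carries no sign that depends on \<open>j\<close>.\<close>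

lemma alternating_form_exchange:
  assumes "alternating_form N f" and "length ys + 1 = N" and "j < length ys"
  shows "f (x # ys[j := y]) = - f (y # ys[j := x])"
proof -
  obtain M where M: "N = Suc M" using assms by (cases N) auto
  have *: "f (a # ys[j := b]) = (-1) ^ j * f (a # b # take j ys @ drop (Suc j) ys)" for a b
    using alternating_form_move[OF alternating_form_Cons[OF assms(1)[unfolded M], of a],
        of "take j ys" "drop (Suc j) ys" b] assms M
    by (simp add: upd_conv_take_nth_drop)
  have "f (x # y # take j ys @ drop (Suc j) ys) = - f (y # x # take j ys @ drop (Suc j) ys)"
    using alternating_form_swap[OF assms(1), of "[]" "take j ys @ drop (Suc j) ys" x y] assms by simp
  then show ?thesis unfolding * by simp
qed

text \<open>Reordering the arguments changes at most the sign, and absolute values suffice wherever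
  only vanishing is at stake.\<close>

lemma alternating_form_abs_eq:
  assumes "alternating_form N f" and "mset xs = mset ys" and "length xs = N"
  shows "\<bar>f xs\<bar> = \<bar>f ys\<bar>"
  using assms
proof (induction xs arbitrary: N f ys)
  case (Cons x xs)
  obtain M where M: "N = Suc M" using Cons.prems(3) by (cases N) auto
  have "x \<in> set ys" using Cons.prems(2) by (metis list.set_intros(1) set_mset_mset)
  then obtain as bs where ys: "ys = as @ x # bs" by (meson split_list)
  have ms: "mset xs = mset (as @ bs)" using Cons.prems(2) ys by simp
  have "\<bar>f ys\<bar> = \<bar>f (x # as @ bs)\<bar>"
    using alternating_form_move[OF Cons.prems(1), of as bs x] Cons.prems(3) mset_eq_length[OF ms] ys
    by (simp add: abs_mult)
  then show ?case
    using Cons.IH[OF alternating_form_Cons[OF Cons.prems(1)[unfolded M], of x] ms] Cons.prems(3) M by simp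
qed simp

text \<open>Reordering brings two equal entries to the front, where swapping them shows that the
  value is its own negative.\<close>

lemma alternating_form_not_distinct:
  assumes "alternating_form N f" and "length xs = N" and "\<not> distinct xs"
  shows "f xs = 0"
proof -
  obtain as x bs cs where xs: "xs = as @ x # bs @ x # cs"
    using not_distinct_decomp[OF assms(3)] by auto
  have "\<bar>f xs\<bar> = \<bar>f ([] @ x # x # as @ bs @ cs)\<bar>"
    by (rule alternating_form_abs_eq[OF assms(1) _ assms(2)]) (simp add: xs)
  moreover have "f ([] @ x # x # as @ bs @ cs) = 0"
    using alternating_form_swap[OF assms(1), of "[]" "as @ bs @ cs" x x] assms(2) xs by simp
  ultimately show ?thesis by simp
qed

lemma alternating_form_eq_0:
  assumes f: "alternating_form N f" and S: "span S = UNIV"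
    and 0: "\<And>ys. set ys \<subseteq> S \<Longrightarrow> distinct ys \<Longrightarrow> length ys = N \<Longrightarrow> f ys = 0"
    and "length xs = N"
  shows "f xs = 0"
proof -
  \<comment> \<open>Multilinearity replaces the entries by elements of \<open>S\<close> one at a
    time: the suffix \<open>bs\<close> already lies in \<open>S\<close>, and the induction shortens
    the arbitrary prefix \<open>as\<close> from its right end.\<close>
  have "f (as @ bs) = 0" if "length as + length bs = N" "set bs \<subseteq> S" for as bs
    using that
  proof (induction as arbitrary: bs rule: rev_induct)
    case Nil
    then show ?case using 0[of bs] alternating_form_not_distinct[OF f, of bs] by fastforce
  next
    case (snoc a as)
    have "linear (\<lambda>x. f (as @ x # bs))"
      using snoc.prems by (intro alternating_form_linear[OF f]) simp
    moreover have "f (as @ x # bs) = 0" if "x \<in> S" for x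
      using snoc.IH[of "x # bs"] snoc.prems that by simp
    ultimately have "f (as @ a # bs) = 0"
      using linear_eq_0_on_span[of "\<lambda>x. f (as @ x # bs)" S a] S by simp
    then show ?case by simp
  qed
  from this[of xs "[]"] show ?thesis using assms(4) by simp
qed

section \<open>Antisymmetrization and powers of a two-form\<close>

text \<open>There is no division by a factorial; the normalization enters later through the
  constants in \<open>wedge\<close>.\<close>

definition alt_sum :: "'a form \<Rightarrow> 'a form" where
  "alt_sum \<Phi> Xs = (\<Sum>\<sigma> | \<sigma> permutes {..<length Xs}. of_int (sign \<sigma>) * \<Phi> (permute_list \<sigma> Xs))"

lemma alt_sum_Nil [simp]: "alt_sum \<Phi> [] = \<Phi> []"
proof -
  have "{\<sigma>. \<sigma> permutes ({}::nat set)} = {id}" by auto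
  then show ?thesis by (simp add: alt_sum_def)
qed

text \<open>Conjugation with \<open>Suc\<close> identifies the permutations of \<open>{..<n}\<close>
  with those of the positions behind the head of a list.\<close>

lemma sum_permutes_Suc_image:
  "(\<Sum>\<sigma> | \<sigma> permutes Suc ` {..<n}. f \<sigma>) = (\<Sum>\<sigma> | \<sigma> permutes {..<n}. f (map_permutation {..<n} Suc \<sigma>))"
proof (rule sum.reindex_bij_witness[where i = "map_permutation {..<n} Suc" and j = "map_permutation (Suc ` {..<n}) (\<lambda>i. i - 1)"])
  have b: "bij_betw Suc {..<n} (Suc ` {..<n})" "bij_betw (\<lambda>i. i - 1) (Suc ` {..<n}) {..<n}"
    by (auto simp: bij_betw_def inj_on_def image_image)
  show "map_permutation {..<n} Suc a \<in> {\<sigma>. \<sigma> permutes Suc ` {..<n}}" if "a \<in> {\<sigma>. \<sigma> permutes {..<n}}" for a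
    using map_permutation_permutes[OF b(1)] that by simp
  show "map_permutation (Suc ` {..<n}) (\<lambda>i. i - 1) a \<in> {\<sigma>. \<sigma> permutes {..<n}}"
    if "a \<in> {\<sigma>. \<sigma> permutes Suc ` {..<n}}" for a
    using map_permutation_permutes[OF b(2)] that by simp
  show inv1: "map_permutation {..<n} Suc (map_permutation (Suc ` {..<n}) (\<lambda>i. i - 1) a) = a"
    if "a \<in> {\<sigma>. \<sigma> permutes Suc ` {..<n}}" for a
    by (rule map_permutation_compose_inv[OF b(2)]) (use that in auto)
  show "map_permutation (Suc ` {..<n}) (\<lambda>i. i - 1) (map_permutation {..<n} Suc a) = a"
    if "a \<in> {\<sigma>. \<sigma> permutes {..<n}}" for a
    by (rule map_permutation_compose_inv[OF b(1)]) (use that in auto)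
  show "f (map_permutation {..<n} Suc (map_permutation (Suc ` {..<n}) (\<lambda>i. i - 1) a)) = f a"
    if "a \<in> {\<sigma>. \<sigma> permutes Suc ` {..<n}}" for a
    using inv1[OF that] by simp
qed

text \<open>A permutation of the positions factors uniquely as the transposition of 0 and
  \<open>b\<close> after a permutation fixing 0. For \<open>b = 0\<close> the head stays; for
  \<open>b = Suc j\<close> the entry \<open>ys ! j\<close> comes to the front, \<open>x\<close>
  takes its place, and the transposition contributes the minus sign.\<close>

lemma alt_sum_Cons:
  "alt_sum \<Phi> (x # ys) = alt_sum (\<lambda>zs. \<Phi> (x # zs)) ys
     - (\<Sum>j<length ys. alt_sum (\<lambda>zs. \<Phi> (ys ! j # zs)) (ys[j := x]))"
proof -
  define n where "n = length ys"
  define F where "F = (\<lambda>\<sigma>. real_of_int (sign \<sigma>) * \<Phi> (permute_list \<sigma> (x # ys)))"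
  have key: "F (Transposition.transpose 0 b \<circ> map_permutation {..<n} Suc p) =
     (if b = 0 then of_int (sign p) * \<Phi> (x # permute_list p ys)
      else - (of_int (sign p) * \<Phi> (ys ! (b - 1) # permute_list p (ys[b - 1 := x]))))"
    if p: "p permutes {..<n}" and b: "b < Suc n" for p b
  proof -
    let ?q = "map_permutation {..<n} Suc p"
    have q: "?q permutes Suc ` {..<n}"
      by (rule map_permutation_permutes[OF _ p]) (auto simp: bij_betw_def)
    have q0: "?q 0 = 0" using permutes_not_in[OF q, of 0] by auto
    have qS: "?q (Suc i) = Suc (p i)" if "i < n" for i
      using that by (intro map_permutation_apply) auto
    have sq: "sign ?q = sign p" by (rule sign_map_permutation[OF _ p]) auto
    have "permutation ?q" using q permutation_permutes by blast
    then have s: "sign (Transposition.transpose 0 b \<circ> ?q) = (if b = 0 then sign p else - sign p)"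
      by (subst sign_compose) (auto simp: sign_swap_id sq permutation_swap_id)
    have pn: "p i < n" if "i < n" for i using permutes_in_image[OF p, of i] that by simp
    have "permute_list (Transposition.transpose 0 b \<circ> ?q) (x # ys) =
        (if b = 0 then x # permute_list p ys else ys ! (b - 1) # permute_list p (ys[b - 1 := x]))" (is "?L = ?R")
    proof (rule nth_equalityI)
      show "length ?L = length ?R" by simp
      fix i assume i: "i < length ?L"
      show "?L ! i = ?R ! i"
      proof (cases i)
        case 0
        then show ?thesis using b q0 by (auto simp: permute_list_def n_def nth_Cons' map_nth simp del: upt_Suc)
      next
        case (Suc m)
        then have m: "m < n" using i by (simp add: n_def)
        have "?L ! i = (x # ys) ! Transposition.transpose 0 b (Suc (p m))"
          using i Suc m qS[OF m] by (simp add: permute_list_def n_def del: upt_Suc)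
        also have "\<dots> = ?R ! i"
          using Suc m pn[OF m] b by (cases b) (auto simp: permute_list_def n_def Transposition.transpose_def nth_list_update)
        finally show ?thesis .
      qed
    qed
    then show ?thesis by (simp add: F_def s)
  qed
  have eq: "{..<length (x # ys)} = insert 0 (Suc ` {..<n})"
    by (auto simp: n_def image_iff lessThan_Suc_eq_insert_0)
  have "alt_sum \<Phi> (x # ys) = (\<Sum>b\<in>insert 0 (Suc ` {..<n}). \<Sum>q | q permutes Suc ` {..<n}. F (Transposition.transpose 0 b \<circ> q))"
    unfolding alt_sum_def eq F_def[symmetric] by (rule sum_over_permutations_insert) auto
  also have "\<dots> = (\<Sum>b\<in>insert 0 (Suc ` {..<n}). \<Sum>p | p permutes {..<n}. F (Transposition.transpose 0 b \<circ> map_permutation {..<n} Suc p))"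
    by (simp add: sum_permutes_Suc_image)
  also have "\<dots> = (\<Sum>p | p permutes {..<n}. F (Transposition.transpose 0 0 \<circ> map_permutation {..<n} Suc p)) +
      (\<Sum>j<n. \<Sum>p | p permutes {..<n}. F (Transposition.transpose 0 (Suc j) \<circ> map_permutation {..<n} Suc p))"
    by (subst sum.insert) (auto simp: sum.reindex)
  also have "\<dots> = alt_sum (\<lambda>zs. \<Phi> (x # zs)) ys
     - (\<Sum>j<length ys. alt_sum (\<lambda>zs. \<Phi> (ys ! j # zs)) (ys[j := x]))"
  proof -
    have "(\<Sum>p | p permutes {..<n}. F (Transposition.transpose 0 0 \<circ> map_permutation {..<n} Suc p)) = alt_sum (\<lambda>zs. \<Phi> (x # zs)) ys"
      unfolding alt_sum_def n_def[symmetric] by (rule sum.cong[OF refl]) (subst key, auto)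
    moreover have "(\<Sum>p | p permutes {..<n}. F (Transposition.transpose 0 (Suc j) \<circ> map_permutation {..<n} Suc p)) =
        - alt_sum (\<lambda>zs. \<Phi> (ys ! j # zs)) (ys[j := x])" if "j < n" for j
      unfolding alt_sum_def length_list_update n_def[symmetric] sum_negf[symmetric]
      by (rule sum.cong[OF refl]) (subst key, use that in auto)
    ultimately show ?thesis by (simp add: sum_negf n_def)
  qed
  finally show ?thesis .
qed

text \<open>Substituting \<open>\<tau> \<circ> \<sigma>\<close> for \<open>\<sigma>\<close> in the
  defining sum takes out the factor \<open>sign \<tau>\<close>, whose square is 1.\<close>

lemma alt_sum_permute_list:
  assumes "\<tau> permutes {..<length Xs}"
  shows "alt_sum \<Phi> (permute_list \<tau> Xs) = of_int (sign \<tau>) * alt_sum \<Phi> Xs"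
proof -
  have "alt_sum \<Phi> Xs = (\<Sum>\<sigma> | \<sigma> permutes {..<length Xs}. of_int (sign (\<tau> \<circ> \<sigma>)) * \<Phi> (permute_list (\<tau> \<circ> \<sigma>) Xs))"
    unfolding alt_sum_def by (rule setum_permutations_compose_left[OF assms]) 
  also have "\<dots> = of_int (sign \<tau>) * alt_sum \<Phi> (permute_list \<tau> Xs)"
    unfolding alt_sum_def sum_distrib_left length_permute_list
  proof (rule sum.cong[OF refl])
    fix \<sigma> assume "\<sigma> \<in> {\<sigma>. \<sigma> permutes {..<length Xs}}"
    then have \<sigma>: "\<sigma> permutes {..<length Xs}" by simp
    have "permutation \<tau>" "permutation \<sigma>" using \<sigma> assms permutation_permutes by blast+
    then show "of_int (sign (\<tau> \<circ> \<sigma>)) * \<Phi> (permute_list (\<tau> \<circ> \<sigma>) Xs) =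
      of_int (sign \<tau>) * (of_int (sign \<sigma>) * \<Phi> (permute_list \<sigma> (permute_list \<tau> Xs)))"
      by (simp add: sign_compose permute_list_compose[OF \<sigma>])
  qed
  finally have "alt_sum \<Phi> Xs = of_int (sign \<tau>) * alt_sum \<Phi> (permute_list \<tau> Xs)" .
  moreover have "real_of_int (sign \<tau>) * of_int (sign \<tau>) = 1"
    by (cases \<tau> rule: sign_cases) simp_all
  ultimately show ?thesis by (simp add: mult.assoc[symmetric])
qed

lemma permute_list_adjacent:
  "permute_list (Transposition.transpose (length as) (Suc (length as))) (as @ x # y # bs) = as @ y # x # bs"
  by (rule nth_equalityI) (auto simp: permute_list_def Transposition.transpose_def nth_append nth_Cons' simp del: upt_Suc)

text \<open>In the term of \<sigma> the head of the list sits at the one position \<open>i\<close>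
  with \<open>\<sigma> i = 0\<close>, so the linearity of \<Phi> in slot \<open>i\<close> applies;
  antisymmetry comes from \<open>alt_sum_permute_list\<close>.\<close>

lemma alternating_form_alt_sum:
  fixes \<Phi> :: "'a::real_vector form"
  assumes lin: "\<And>Xs i. length Xs = N \<Longrightarrow> i < N \<Longrightarrow> linear (\<lambda>x. \<Phi> (Xs[i := x]))"
  shows "alternating_form N (alt_sum \<Phi>)"
  unfolding alternating_form_def
proof (intro conjI allI impI)
  fix ys :: "'a list" assume l: "Suc (length ys) = N"
  have "linear (\<lambda>x. of_int (sign \<sigma>) *\<^sub>R \<Phi> (permute_list \<sigma> (x # ys)))" if \<sigma>: "\<sigma> permutes {..<N}" for \<sigma>
  proof -
    obtain i where i: "i < N" "\<sigma> i = 0"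
      using permutes_image[OF \<sigma>] l by (metis imageE lessThan_iff zero_less_Suc)
    have "permute_list \<sigma> (x # ys) = (permute_list \<sigma> (0 # ys))[i := x]" for x
    proof (rule nth_equalityI)
      fix m assume "m < length (permute_list \<sigma> (x # ys))"
      then have m: "m < N" using l by simp
      have "\<sigma> m = 0 \<longleftrightarrow> m = i" using i permutes_inj[OF \<sigma>] by (metis injD)
      then show "permute_list \<sigma> (x # ys) ! m = (permute_list \<sigma> (0 # ys))[i := x] ! m"
        using m l i by (auto simp: permute_list_def nth_list_update nth_Cons' simp del: upt_Suc)
    qed simp
    then have "(\<lambda>x. \<Phi> (permute_list \<sigma> (x # ys))) = (\<lambda>x. \<Phi> ((permute_list \<sigma> (0 # ys))[i := x]))"
      by (intro ext arg_cong[where f = \<Phi>])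
    then show ?thesis using lin[of "permute_list \<sigma> (0 # ys)" i] i l
      by (intro linear_compose_scale_right) simp
  qed
  then have "linear (\<lambda>x. of_int (sign \<sigma>) * \<Phi> (permute_list \<sigma> (x # ys)))" if "\<sigma> permutes {..<N}" for \<sigma>
    using that by simp
  then have "linear (\<lambda>x. \<Sum>\<sigma> | \<sigma> permutes {..<N}. of_int (sign \<sigma>) * \<Phi> (permute_list \<sigma> (x # ys)))"
    by (intro linear_compose_sum) simp
  then show "linear (\<lambda>x. alt_sum \<Phi> (x # ys))"
    by (simp add: alt_sum_def l)
next
  fix as bs :: "'a list" and x y assume l: "length as + length bs + 2 = N"
  have "Transposition.transpose (length as) (Suc (length as)) permutes {..<length (as @ y # x # bs)}"
    by (rule permutes_swap_id) auto
  from alt_sum_permute_list[OF this, of \<Phi>]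
  show "alt_sum \<Phi> (as @ x # y # bs) = - alt_sum \<Phi> (as @ y # x # bs)"
    by (simp add: permute_list_adjacent sign_swap_id)
qed

text \<open>All \<open>Suc N\<close> terms of the recursion \<open>alt_sum_Cons\<close> agree, since
  exchanging \<open>x\<close> with \<open>ys ! j\<close> cancels the minus sign.\<close>

lemma alt_sum_alternating:
  assumes "alternating_form N f" and "length Xs = N"
  shows "alt_sum f Xs = fact N * f Xs"
  using assms
proof (induction N arbitrary: f Xs)
  case (Suc N)
  obtain x ys where Xs: "Xs = x # ys" and l: "length ys = N" using Suc.prems(2) by (cases Xs) auto
  have 1: "alt_sum (\<lambda>zs. f (z # zs)) ws = fact N * f (z # ws)" if "length ws = N" for z ws
    using Suc.IH[OF alternating_form_Cons[OF Suc.prems(1)] that] .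
  have "alt_sum (\<lambda>zs. f (ys ! j # zs)) (ys[j := x]) = - (fact N * f (x # ys))" if "j < length ys" for j
    using alternating_form_exchange[OF Suc.prems(1), of ys j "ys ! j" x] that l by (simp add: 1)
  then show ?case by (simp add: Xs alt_sum_Cons 1 l algebra_simps)
qed simp

section \<open>Wedge products with a two-form as antisymmetrized tensor products\<close>

definition two_wedge :: "'a form \<Rightarrow> 'a form \<Rightarrow> 'a form" where
  "two_wedge \<omega> \<beta> Xs = \<omega> (take 2 Xs) * \<beta> (drop 2 Xs)"

lemma wedge_2_eq_alt_sum:
  assumes "length Xs = 2 + q"
  shows "wedge 2 q \<omega> \<beta> Xs = alt_sum (two_wedge \<omega> \<beta>) Xs / (2 * fact q)"
proof -
  have "take 2 (permute_list \<sigma> Xs) = map (\<lambda>i. Xs ! \<sigma> i) [0..<2]" for \<sigma>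
    using assms by (simp add: permute_list_def take_map take_upt numeral_2_eq_2 del: upt_Suc)
  moreover have "drop 2 (permute_list \<sigma> Xs) = map (\<lambda>i. Xs ! \<sigma> i) [2..<2 + q]" for \<sigma>
    using assms by (simp add: permute_list_def drop_map drop_upt numeral_2_eq_2 del: upt_Suc)
  ultimately show ?thesis
    using assms by (simp add: wedge_def alt_sum_def two_wedge_def mult.assoc del: upt_Suc)
qed

lemma alternating_form_update:
  assumes "alternating_form N f" and "length Xs = N" and "i < N"
  shows "linear (\<lambda>x. f (Xs[i := x]))"
  using alternating_form_linear[OF assms(1), of "take i Xs" "drop (Suc i) Xs"] assms
  by (simp add: upd_conv_take_nth_drop)

lemma alternating_form_alt_sum_two_wedge:
  assumes \<omega>: "alternating_form 2 \<omega>" and \<beta>: "alternating_form q \<beta>"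
  shows "alternating_form (2 + q) (alt_sum (two_wedge \<omega> \<beta>))"
proof (rule alternating_form_alt_sum)
  fix Xs :: "'a list" and i assume l: "length Xs = 2 + q" and i: "i < 2 + q"
  show "linear (\<lambda>x. two_wedge \<omega> \<beta> (Xs[i := x]))"
  proof (cases "i < 2")
    case True
    have "linear (\<lambda>x. \<beta> (drop 2 Xs) *\<^sub>R \<omega> ((take 2 Xs)[i := x]))"
      using True l by (intro linear_compose_scale_right alternating_form_update[OF \<omega>]) auto
    then show ?thesis
      using True by (simp add: two_wedge_def take_update_swap mult.commute)
  next
    case False
    have "linear (\<lambda>x. \<omega> (take 2 Xs) *\<^sub>R \<beta> ((drop 2 Xs)[i - 2 := x]))"
      using False l i by (intro linear_compose_scale_right alternating_form_update[OF \<beta>]) auto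
    then show ?thesis
      using False by (simp add: two_wedge_def drop_update_swap)
  qed
qed

lemma alternating_form_cong_scale:
  assumes "alternating_form N f" and "\<And>xs. length xs = N \<Longrightarrow> g xs = c * f xs"
  shows "alternating_form N g"
proof -
  have "linear (\<lambda>x. g (x # ys))" if "Suc (length ys) = N" for ys
  proof -
    have "linear (\<lambda>x. c *\<^sub>R f (x # ys))"
      using that by (intro linear_compose_scale_right alternating_form_linear_Cons[OF assms(1)])
    then show ?thesis using assms(2)[of "_ # ys"] that by simp
  qed
  moreover have "g (as @ x # y # bs) = - g (as @ y # x # bs)" if "length as + length bs + 2 = N" for as x y bs
    using alternating_form_swap[OF assms(1) that, of x y] assms(2)[of "as @ x # y # bs"]
      assms(2)[of "as @ y # x # bs"] that by simp
  ultimately show ?thesis unfolding alternating_form_def by blast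
qed

lemma two_form_power_Suc_eq:
  assumes "length Xs = 2 + 2 * k"
  shows "two_form_power \<omega> (Suc k) Xs = alt_sum (two_wedge \<omega> (two_form_power \<omega> k)) Xs / (2 * fact (2 * k))"
  using wedge_2_eq_alt_sum[OF assms, of \<omega> "two_form_power \<omega> k"] by simp

lemma alternating_form_two_form_power:
  assumes "alternating_form 2 \<omega>"
  shows "alternating_form (2 * k) (two_form_power \<omega> k)"
proof (induction k)
  case 0
  show ?case by (simp add: alternating_form_def)
next
  case (Suc k)
  show ?case
    by (rule alternating_form_cong_scale[where c = "1 / (2 * fact (2 * k))"])
      (use alternating_form_alt_sum_two_wedge[OF assms Suc] in \<open>simp_all add: two_form_power_Suc_eq del: two_form_power.simps\<close>)
qed

text \<open>In every term of the antisymmetrization \<open>x\<close> is an argument either of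
  \<omega> or of the lower power, which vanishes by induction.\<close>

lemma two_form_power_kernel:
  assumes "length Xs = 2 * k" and "x \<in> set Xs"
    and "\<And>y. y \<in> set Xs \<Longrightarrow> \<omega> [x, y] = 0" and "\<And>y. y \<in> set Xs \<Longrightarrow> \<omega> [y, x] = 0"
  shows "two_form_power \<omega> k Xs = 0"
  using assms
proof (induction k arbitrary: Xs)
  case (Suc k)
  have "two_wedge \<omega> (two_form_power \<omega> k) (permute_list \<sigma> Xs) = 0" if \<sigma>: "\<sigma> permutes {..<length Xs}" for \<sigma>
  proof -
    let ?Y = "permute_list \<sigma> Xs"
    have s: "set ?Y = set Xs" using \<sigma> by simp
    obtain a b zs where Y: "?Y = a # b # zs" using Suc.prems(1)
      by (metis (no_types, lifting) Suc_length_conv length_permute_list mult_Suc_right numeral_2_eq_2 plus_nat.simps(2) add_Suc)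
    have l: "length zs = 2 * k" using Suc.prems(1) arg_cong[OF Y, of length] by simp
    have "x = a \<or> x = b \<or> x \<in> set zs" using Suc.prems(2) s Y by auto
    moreover have "set zs \<subseteq> set Xs" "a \<in> set Xs" "b \<in> set Xs" using s Y by auto
    ultimately show ?thesis
      using Suc.IH[of zs] Suc.prems(3,4) l unfolding Y two_wedge_def
      by (auto simp: subset_iff numeral_2_eq_2)
  qed
  then have "alt_sum (two_wedge \<omega> (two_form_power \<omega> k)) Xs = 0"
    unfolding alt_sum_def by (intro sum.neutral) auto
  then show ?case using Suc.prems(1) by (subst two_form_power_Suc_eq) auto
qed simp

text \<open>
  Up to the factor \<open>fact q\<close>, \<open>front \<omega> w \<gamma>\<close> is the antisymmetrization of \<open>\<omega>(w, \<cdot>) \<otimes> \<gamma>\<close> for an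
  alternating \<open>\<gamma>\<close> of degree \<open>q\<close>. The entry moved to the front is replaced by the head of the list
  rather than deleted, which avoids the signs \<open>(-1)\<^sup>j\<close>.
\<close>

definition front :: "'a form \<Rightarrow> 'a \<Rightarrow> 'a form \<Rightarrow> 'a form" where
  "front \<omega> w \<gamma> Ys = (case Ys of [] \<Rightarrow> 0 | a # as \<Rightarrow>
     \<omega> [w, a] * \<gamma> as - (\<Sum>j<length as. \<omega> [w, as ! j] * \<gamma> (as[j := a])))"

lemma alt_sum_scale: "alt_sum (\<lambda>zs. c * \<beta> zs) Xs = c * alt_sum \<beta> Xs"
  by (simp add: alt_sum_def sum_distrib_left mult.left_commute)

text \<open>\<open>alt_sum_Cons\<close> is applied twice, once for each argument of \<omega>; what
  remains is the antisymmetrization of the alternating \<beta>, which only contributes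
  \<open>fact q\<close>.\<close>

lemma alt_sum_two_wedge:
  assumes \<beta>: "alternating_form q \<beta>" and l: "length ys = Suc q"
  shows "alt_sum (two_wedge \<omega> \<beta>) (x # ys) =
    fact q * (front \<omega> x \<beta> ys - (\<Sum>j<length ys. front \<omega> (ys ! j) \<beta> (ys[j := x])))"
proof -
  have *: "alt_sum (\<lambda>zs. two_wedge \<omega> \<beta> (w # zs)) ws = fact q * front \<omega> w \<beta> ws" if lw: "length ws = Suc q" for w ws
  proof -
    obtain a as where ws: "ws = a # as" and la: "length as = q" using lw by (cases ws) auto
    have "alt_sum (\<lambda>zs. two_wedge \<omega> \<beta> (w # b # zs)) bs = \<omega> [w, b] * (fact q * \<beta> bs)" if "length bs = q" for b bs
      using alt_sum_alternating[OF \<beta> that] by (simp add: two_wedge_def alt_sum_scale)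
    then show ?thesis
      by (simp add: ws front_def alt_sum_Cons la right_diff_distrib sum_distrib_left mult.left_commute)
  qed
  then show ?thesis
    by (simp add: alt_sum_Cons l right_diff_distrib sum_distrib_left del: sum.lessThan_Suc)
qed

text \<open>The term with \<open>i = 0\<close> has \<open>y\<close> in front already; in the others,
  exchanging \<open>y\<close> with the head \<open>a\<close> yields the minus signs of
  \<open>front\<close>.\<close>

lemma front_eq_sum_update:
  assumes "alternating_form (Suc N) \<beta>" and "length ws = Suc N"
  shows "(\<Sum>i<length ws. \<omega> [w, ws ! i] * \<beta> (ws[i := y])) = front \<omega> w (\<lambda>zs. \<beta> (y # zs)) ws"
proof -
  obtain a as where ws: "ws = a # as" and la: "length as = N" using assms(2) by (cases ws) auto
  have "\<beta> (a # as[j := y]) = - \<beta> (y # as[j := a])" if "j < N" for j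
    using alternating_form_exchange[OF assms(1), of as j a y] that la by simp
  then show ?thesis
    by (simp add: ws front_def sum.lessThan_Suc_shift la sum_negf[symmetric] del: sum.lessThan_Suc)
qed

text \<open>Taking two entries out of \<open>zs\<close> for \<omega> and putting \<open>x\<close>
  and \<open>y\<close> in their places amounts to contracting \<beta> with \<open>x\<close> and
  \<open>y\<close> first, because moving \<open>x\<close> and \<open>y\<close> to the front produces
  the right signs. The factor \<open>fact q\<close> counts the orders of the other entries.\<close>

lemma alt_sum_two_wedge_eq_sum_update:
  assumes \<beta>: "alternating_form (Suc (Suc q)) \<beta>" and l: "length zs = Suc (Suc q)"
  shows "fact q * (\<Sum>j<length zs. \<Sum>i\<in>{..<length zs} - {j}. \<omega> [zs ! j, zs ! i] * \<beta> (zs[j := x, i := y]))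
     = alt_sum (two_wedge \<omega> (\<lambda>us. \<beta> (x # y # us))) zs"
proof -
  obtain a ys where zs: "zs = a # ys" and ly: "length ys = Suc q" using l by (cases zs) auto
  let ?\<gamma> = "\<lambda>us. \<beta> (x # y # us)"
  have \<beta>x: "alternating_form (Suc q) (\<lambda>us. \<beta> (v # us))" for v
    using alternating_form_Cons[OF \<beta>] .
  have \<gamma>: "alternating_form q ?\<gamma>" using alternating_form_Cons[OF \<beta>x] .
  have 0: "(\<Sum>i\<in>{..<length zs} - {0}. \<omega> [zs ! 0, zs ! i] * \<beta> (zs[0 := x, i := y])) = front \<omega> a ?\<gamma> ys"
  proof -
    have "{..<length zs} - {0} = Suc ` {..<length ys}" by (auto simp: zs lessThan_Suc_eq_insert_0)
    then show ?thesis
      using front_eq_sum_update[OF \<beta>x[of x] ly, of \<omega> a y] by (simp add: sum.reindex zs)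
  qed
  have S: "(\<Sum>i\<in>{..<length zs} - {Suc j}. \<omega> [zs ! Suc j, zs ! i] * \<beta> (zs[Suc j := x, i := y]))
      = - front \<omega> (ys ! j) ?\<gamma> (ys[j := a])" if j: "j < length ys" for j
  proof -
    let ?t = "\<lambda>i. \<omega> [ys ! j, ys[j := a] ! i] * \<beta> (x # ys[j := a, i := y])"
    have set: "{..<length zs} - {Suc j} = insert 0 (Suc ` ({..<length ys} - {j}))"
    proof -
      have "i \<in> Suc ` ({..<length ys} - {j})" if "i < Suc (length ys)" "i \<noteq> Suc j" "i \<noteq> 0" for i
        using that by (cases i) auto
      then show ?thesis by (auto simp: zs)
    qed
    have a: "\<omega> [ys ! j, a] * \<beta> (y # ys[j := x]) = - ?t j"
      using alternating_form_exchange[OF \<beta>, of ys j y x] ly j by simp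
    have b: "\<omega> [ys ! j, ys ! i] * \<beta> (a # ys[j := x, i := y]) = - ?t i" if "i < length ys" "i \<noteq> j" for i
      using alternating_form_exchange[OF \<beta>, of "ys[i := y]" j a x] ly j that
      by (simp add: list_update_swap)
    have "(\<Sum>i\<in>{..<length zs} - {Suc j}. \<omega> [zs ! Suc j, zs ! i] * \<beta> (zs[Suc j := x, i := y]))
        = \<omega> [ys ! j, a] * \<beta> (y # ys[j := x]) + (\<Sum>i\<in>{..<length ys} - {j}. \<omega> [ys ! j, ys ! i] * \<beta> (a # ys[j := x, i := y]))"
      unfolding set by (simp add: sum.reindex zs)
    also have "\<dots> = - ?t j + (\<Sum>i\<in>{..<length ys} - {j}. - ?t i)"
      unfolding a by (intro arg_cong2[of _ _ _ _ "(+)"] refl sum.cong) (use b in auto)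
    also have "\<dots> = - (\<Sum>i<length ys. ?t i)"
      using j by (simp add: sum.remove[of "{..<length ys}" j] sum_negf)
    also have "(\<Sum>i<length ys. ?t i) = front \<omega> (ys ! j) ?\<gamma> (ys[j := a])"
      using front_eq_sum_update[OF \<beta>x[of x], of "ys[j := a]" \<omega> "ys ! j" y] ly by simp
    finally show ?thesis .
  qed
  have "(\<Sum>j<length zs. \<Sum>i\<in>{..<length zs} - {j}. \<omega> [zs ! j, zs ! i] * \<beta> (zs[j := x, i := y]))
     = front \<omega> a ?\<gamma> ys + (\<Sum>j<length ys. - front \<omega> (ys ! j) ?\<gamma> (ys[j := a]))"
  proof -
    have "(\<Sum>j<Suc (length ys). \<Sum>i\<in>{..<length zs} - {j}. \<omega> [zs ! j, zs ! i] * \<beta> (zs[j := x, i := y]))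
     = front \<omega> a ?\<gamma> ys + (\<Sum>j<length ys. - front \<omega> (ys ! j) ?\<gamma> (ys[j := a]))"
      unfolding sum.lessThan_Suc_shift 0 by (intro arg_cong2[of _ _ _ _ "(+)"] refl sum.cong) (use S in auto)
    then show ?thesis by (simp add: zs)
  qed
  then show ?thesis
    using alt_sum_two_wedge[OF \<gamma> ly, of \<omega> a] by (simp add: zs sum_negf)
qed

text \<open>As \<open>x\<close> and \<open>y\<close> are \<omega>-orthogonal to \<open>zs\<close>,
  only terms in which they meet in the same factor \<omega> survive, and there are
  \<open>Suc k\<close> such factors. The induction distinguishes whether this is the leading
  factor.\<close>

lemma two_form_power_split:
  assumes \<omega>: "alternating_form 2 \<omega>" and l: "length zs = 2 * k"
    and xz: "\<And>z. z \<in> set zs \<Longrightarrow> \<omega> [x, z] = 0" and yz: "\<And>z. z \<in> set zs \<Longrightarrow> \<omega> [y, z] = 0"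
  shows "two_form_power \<omega> (Suc k) (x # y # zs) = real (Suc k) * \<omega> [x, y] * two_form_power \<omega> k zs"
  using l xz yz
proof (induction k arbitrary: zs)
  case 0
  have "\<omega> [y, x] = - \<omega> [x, y]" using alternating_form_swap[OF \<omega>, of "[]" "[]" y x] by simp
  then show ?case using 0 by (subst two_form_power_Suc_eq) (simp_all add: alt_sum_Cons two_wedge_def)
next
  case (Suc k)
  note swap = alternating_form_swap[OF \<omega>, of "[]" "[]", simplified]
  have zx: "\<omega> [z, x] = 0" and zy: "\<omega> [z, y] = 0" if "z \<in> set zs" for z
    using Suc.prems(2,3)[OF that] swap[of z x] swap[of z y] by auto
  let ?\<beta> = "two_form_power \<omega> (Suc k)"
  have \<beta>: "alternating_form (Suc (Suc (2 * k))) ?\<beta>"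
    using alternating_form_two_form_power[OF \<omega>, of "Suc k"] by simp
  have l: "length zs = Suc (Suc (2 * k))" using Suc.prems(1) by simp
  have 1: "front \<omega> x ?\<beta> (y # zs) = \<omega> [x, y] * ?\<beta> zs"
    using Suc.prems(2) by (simp add: front_def del: two_form_power.simps)
  have 2: "front \<omega> y ?\<beta> (x # zs) = - \<omega> [x, y] * ?\<beta> zs"
    using Suc.prems(3) swap[of y x] by (simp add: front_def del: two_form_power.simps)
  have 3: "front \<omega> (zs ! j) ?\<beta> (y # zs[j := x]) =
     - (\<Sum>i\<in>{..<length zs} - {j}. \<omega> [zs ! j, zs ! i] * ?\<beta> (zs[j := x, i := y]))" if j: "j < length zs" for j
  proof -
    have "front \<omega> (zs ! j) ?\<beta> (y # zs[j := x]) =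
      - (\<Sum>i<length zs. \<omega> [zs ! j, zs[j := x] ! i] * ?\<beta> (zs[j := x, i := y]))"
      using zy j by (simp add: front_def del: two_form_power.simps)
    also have "(\<Sum>i<length zs. \<omega> [zs ! j, zs[j := x] ! i] * ?\<beta> (zs[j := x, i := y])) =
       (\<Sum>i\<in>{..<length zs} - {j}. \<omega> [zs ! j, zs[j := x] ! i] * ?\<beta> (zs[j := x, i := y]))"
      using j zx by (simp add: sum.remove[of "{..<length zs}" j] del: two_form_power.simps)
    also have "\<dots> = (\<Sum>i\<in>{..<length zs} - {j}. \<omega> [zs ! j, zs ! i] * ?\<beta> (zs[j := x, i := y]))"
      by (intro sum.cong refl) (auto simp del: two_form_power.simps)
    finally show ?thesis .
  qed
  let ?\<gamma> = "two_form_power \<omega> k"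
  have 4: "alt_sum (two_wedge \<omega> (\<lambda>us. ?\<beta> (x # y # us))) zs =
     real (Suc k) * \<omega> [x, y] * alt_sum (two_wedge \<omega> ?\<gamma>) zs"
    unfolding alt_sum_def sum_distrib_left
  proof (intro sum.cong refl)
    fix \<sigma> assume "\<sigma> \<in> {\<sigma>. \<sigma> permutes {..<length zs}}"
    then have "set (permute_list \<sigma> zs) = set zs" by simp
    then have "set (drop 2 (permute_list \<sigma> zs)) \<subseteq> set zs" using set_drop_subset by metis
    moreover have "length (drop 2 (permute_list \<sigma> zs)) = 2 * k" using l by simp
    ultimately have "?\<beta> (x # y # drop 2 (permute_list \<sigma> zs)) =
       real (Suc k) * \<omega> [x, y] * ?\<gamma> (drop 2 (permute_list \<sigma> zs))"
      using Suc.IH[of "drop 2 (permute_list \<sigma> zs)"] Suc.prems(2,3) by blast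
    then show "real_of_int (sign \<sigma>) * two_wedge \<omega> (\<lambda>us. ?\<beta> (x # y # us)) (permute_list \<sigma> zs) =
        real (Suc k) * \<omega> [x, y] * (real_of_int (sign \<sigma>) * two_wedge \<omega> ?\<gamma> (permute_list \<sigma> zs))"
      by (simp add: two_wedge_def del: two_form_power.simps)
  qed
  let ?q = "2 * Suc k"
  \<comment> \<open>The first two summands have \<open>x\<close> and \<open>y\<close>, in either
    order, as the arguments of the leading \<omega>; \<open>?S\<close> collects the terms with both
    inside \<open>?\<beta>\<close>. Terms that separate them vanish.\<close>
  have "alt_sum (two_wedge \<omega> ?\<beta>) (x # y # zs) =
     fact ?q * (\<omega> [x, y] * ?\<beta> zs + \<omega> [x, y] * ?\<beta> zs +
       (\<Sum>j<length zs. \<Sum>i\<in>{..<length zs} - {j}. \<omega> [zs ! j, zs ! i] * ?\<beta> (zs[j := x, i := y])))"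
    (is "_ = _ * (_ + _ + ?S)")
  proof -
    have "alt_sum (two_wedge \<omega> ?\<beta>) (x # y # zs) =
      fact ?q * (front \<omega> x ?\<beta> (y # zs) - (\<Sum>j<Suc (length zs). front \<omega> ((y # zs) ! j) ?\<beta> ((y # zs)[j := x])))"
      using alt_sum_two_wedge[of ?q ?\<beta> "y # zs" \<omega> x] \<beta> l by (simp del: two_form_power.simps sum.lessThan_Suc)
    also have "(\<Sum>j<Suc (length zs). front \<omega> ((y # zs) ! j) ?\<beta> ((y # zs)[j := x])) =
      - \<omega> [x, y] * ?\<beta> zs - ?S"
      unfolding sum.lessThan_Suc_shift using 2 3 by (simp add: sum_negf del: two_form_power.simps)
    finally show ?thesis using 1 by (simp del: two_form_power.simps)
  qed
  also have "fact (2 * k) * ?S = real (Suc k) * \<omega> [x, y] * alt_sum (two_wedge \<omega> ?\<gamma>) zs"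
    using alt_sum_two_wedge_eq_sum_update[OF \<beta> l, of \<omega> x y] 4 by simp
  then have "?S = 2 * real (Suc k) * \<omega> [x, y] * ?\<beta> zs"
    using l by (subst two_form_power_Suc_eq) (simp_all add: field_simps)
  \<comment> \<open>The constants add up as \<open>2 + 2 * (k + 1) = 2 * (k + 2)\<close>.\<close>
  finally have "alt_sum (two_wedge \<omega> ?\<beta>) (x # y # zs) = 2 * fact ?q * (real (Suc (Suc k)) * \<omega> [x, y] * ?\<beta> zs)"
    by (simp add: algebra_simps del: two_form_power.simps)
  then show ?case
    using Suc.prems(1) by (subst two_form_power_Suc_eq) (simp_all del: two_form_power.simps fact_Suc)
qed

section \<open>The Chevalley-Eilenberg differential\<close>

text \<open>For \<open>T = br X\<close> this is minus the Lie derivative of a left-invariant form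
  along \<open>X\<close>.\<close>

definition derivation :: "('a \<Rightarrow> 'a) \<Rightarrow> 'a form \<Rightarrow> 'a form" where
  "derivation T f Ys = (\<Sum>j<length Ys. f (Ys[j := T (Ys ! j)]))"

lemma derivation_Nil [simp]: "derivation T f [] = 0"
  by (simp add: derivation_def)

lemma derivation_Cons:
  "derivation T f (y # ys) = f (T y # ys) + derivation T (\<lambda>zs. f (y # zs)) ys"
  by (simp add: derivation_def sum.lessThan_Suc_shift del: sum.lessThan_Suc)

lemma derivation_cong_scale:
  assumes "\<And>zs. length zs = length ys \<Longrightarrow> f zs = c * g zs"
  shows "derivation T f ys = c * derivation T g ys"
  using assms by (simp add: derivation_def sum_distrib_left)

lemma derivation_swap:
  assumes "alternating_form N f" and "length as + length bs + 2 = N"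
  shows "derivation T f (as @ x # y # bs) = - derivation T f (as @ y # x # bs)"
  using assms
proof (induction as arbitrary: N f)
  case Nil
  note swap = alternating_form_swap[OF Nil.prems(1), of "[]", simplified]
  have "derivation T (\<lambda>zs. f (x # y # zs)) bs = - 1 * derivation T (\<lambda>zs. f (y # x # zs)) bs"
    using Nil.prems(2) swap[of _ x y] by (intro derivation_cong_scale) simp
  then show ?case
    using Nil.prems(2) swap[of bs "T x" y] swap[of bs x "T y"] by (simp add: derivation_Cons)
next
  case (Cons a as)
  obtain M where M: "N = Suc M" using Cons.prems(2) by (cases N) auto
  have "f (T a # as @ x # y # bs) = - f (T a # as @ y # x # bs)"
    using alternating_form_swap[OF Cons.prems(1), of "T a # as" bs x y] Cons.prems(2) by simp
  then show ?case
    using Cons.IH[OF alternating_form_Cons[OF Cons.prems(1)[unfolded M], of a]] Cons.prems(2) M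
    by (simp add: derivation_Cons)
qed

lemma nths_remove1:
  "j < length xs \<Longrightarrow> nths xs (- {j}) = take j xs @ drop (Suc j) xs"
proof (induction xs arbitrary: j)
  case (Cons x xs)
  show ?case
  proof (cases j)
    case 0
    have "nths xs UNIV = xs" by (rule nths_all) simp
    then show ?thesis using 0 by (simp add: nths_Cons)
  next
    case (Suc m)
    then have "{i. Suc i \<in> - {j}} = - {m}" by auto
    then show ?thesis using Suc Cons by (simp add: nths_Cons)
  qed
qed simp

lemma length_nths_remove2:
  assumes "i < j" and "j < length xs"
  shows "length (nths xs (- {i, j})) + 2 = length xs"
proof -
  have "{k. k < length xs \<and> k \<in> - {i, j}} = {..<length xs} - {i, j}" by auto
  then show ?thesis using assms by (simp add: length_nths card_Diff_subset)
qed

lemma ce_differential_cong_scale: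
  assumes "\<And>Ys. Suc (length Ys) = length Xs \<Longrightarrow> \<alpha> Ys = c * \<beta> Ys"
  shows "ce_differential br \<alpha> Xs = c * ce_differential br \<beta> Xs"
  unfolding ce_differential_def sum_distrib_left
proof (intro sum.cong refl)
  fix j i assume "j \<in> {..<length Xs}" "i \<in> {..<j}"
  then have "\<alpha> (br (Xs ! i) (Xs ! j) # nths Xs (- {i, j})) = c * \<beta> (br (Xs ! i) (Xs ! j) # nths Xs (- {i, j}))"
    using length_nths_remove2[of i j Xs] by (intro assms) simp
  then show "(- 1) ^ (i + j) * \<alpha> (br (Xs ! i) (Xs ! j) # nths Xs (- {i, j})) =
    c * ((- 1) ^ (i + j) * \<beta> (br (Xs ! i) (Xs ! j) # nths Xs (- {i, j})))" by simp
qed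

text \<open>Cartan's formula \<open>\<iota>\<^sub>X d = L\<^sub>X - d \<iota>\<^sub>X\<close>.\<close>

lemma ce_differential_Cons:
  assumes \<alpha>: "alternating_form (length Xs) \<alpha>"
  shows "ce_differential br \<alpha> (X # Xs) =
    - derivation (br X) \<alpha> Xs - ce_differential br (\<lambda>Ys. \<alpha> (X # Ys)) Xs"
proof -
  let ?n = "length Xs"
  let ?t = "\<lambda>i j. (-1) ^ (i + j) * \<alpha> (br ((X # Xs) ! i) ((X # Xs) ! j) # nths (X # Xs) (- {i, j}))"
  \<comment> \<open>The pairs that involve \<open>X\<close> give the derivation: moving the bracket
    back to position \<open>j\<close> absorbs \<open>(-1) ^ j\<close>.\<close>
  have 1: "?t 0 (Suc j) = - \<alpha> (Xs[j := br X (Xs ! j)])" if j: "j < ?n" for j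
  proof -
    have "{i. Suc i \<in> - {0, Suc j}} = - {j}" by auto
    then have "?t 0 (Suc j) = - ((-1) ^ j * \<alpha> (br X (Xs ! j) # take j Xs @ drop (Suc j) Xs))"
      using nths_remove1[OF j] by (simp add: nths_Cons)
    also have "(-1) ^ j * \<alpha> (br X (Xs ! j) # take j Xs @ drop (Suc j) Xs) = \<alpha> (Xs[j := br X (Xs ! j)])"
      using alternating_form_move[OF \<alpha>, of "take j Xs" "drop (Suc j) Xs"] j
      by (simp add: upd_conv_take_nth_drop)
    finally show ?thesis .
  qed
  \<comment> \<open>For the other pairs \<open>X\<close> has to pass the bracket to get to the
    front, which costs one sign.\<close>
  have 2: "?t (Suc i) (Suc j) = - ((-1) ^ (i + j) * \<alpha> (X # br (Xs ! i) (Xs ! j) # nths Xs (- {i, j})))"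
    if "i < j" "j < ?n" for i j
  proof -
    have "{k. Suc k \<in> - {Suc i, Suc j}} = - {i, j}" by auto
    moreover have "\<alpha> (br (Xs ! i) (Xs ! j) # X # nths Xs (- {i, j})) = - \<alpha> (X # br (Xs ! i) (Xs ! j) # nths Xs (- {i, j}))"
      using alternating_form_swap[OF \<alpha>, of "[]" "nths Xs (- {i, j})" "br (Xs ! i) (Xs ! j)" X]
        length_nths_remove2[OF that] by simp
    ultimately show ?thesis by (simp add: nths_Cons)
  qed
  have "ce_differential br \<alpha> (X # Xs) = (\<Sum>j<?n. \<Sum>i<Suc j. ?t i (Suc j))"
    unfolding ce_differential_def by (simp only: length_Cons sum.lessThan_Suc_shift[of _ ?n]) simp
  also have "\<dots> = (\<Sum>j<?n. ?t 0 (Suc j) + (\<Sum>i<j. ?t (Suc i) (Suc j)))"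
    by (simp only: sum.lessThan_Suc_shift)
  also have "\<dots> = (\<Sum>j<?n. - \<alpha> (Xs[j := br X (Xs ! j)]) +
      (\<Sum>i<j. - ((-1) ^ (i + j) * \<alpha> (X # br (Xs ! i) (Xs ! j) # nths Xs (- {i, j})))))"
    using 1 2 by (intro sum.cong arg_cong2[of _ _ _ _ "(+)"] refl) auto
  also have "\<dots> = - derivation (br X) \<alpha> Xs - ce_differential br (\<lambda>Ys. \<alpha> (X # Ys)) Xs"
    by (simp add: sum_subtractf sum_negf derivation_def ce_differential_def)
  finally show ?thesis .
qed

text \<open>For a swap at the front, two applications of Cartan's formula display all terms
  explicitly; a swap further back passes through Cartan's formula to the tail by induction.\<close>

lemma ce_differential_swap:
  assumes "\<And>X Y. br X Y = - br Y X" and "alternating_form N \<alpha>" and "length as + length bs + 1 = N"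
  shows "ce_differential br \<alpha> (as @ x # y # bs) = - ce_differential br \<alpha> (as @ y # x # bs)"
  using assms(2,3)
proof (induction as arbitrary: N \<alpha>)
  case Nil
  have N: "N = Suc (length bs)" using Nil.prems(2) by simp
  note \<alpha> = Nil.prems(1)[unfolded N]
  have *: "ce_differential br \<alpha> (u # v # bs) = - \<alpha> (br u v # bs) - derivation (br u) (\<lambda>zs. \<alpha> (v # zs)) bs
      + derivation (br v) (\<lambda>zs. \<alpha> (u # zs)) bs + ce_differential br (\<lambda>zs. \<alpha> (u # v # zs)) bs" for u v
    using ce_differential_Cons[of "v # bs" \<alpha> br u] ce_differential_Cons[of bs "\<lambda>zs. \<alpha> (u # zs)" br v]
      \<alpha> alternating_form_Cons[OF \<alpha>, of u] by (simp add: derivation_Cons)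
  have "linear (\<lambda>z. \<alpha> (z # bs))" by (rule alternating_form_linear_Cons[OF \<alpha>]) simp
  then have "\<alpha> (br x y # bs) = - \<alpha> (br y x # bs)"
    using assms(1)[of x y] by (metis linear_neg)
  moreover have "ce_differential br (\<lambda>zs. \<alpha> (x # y # zs)) bs = - 1 * ce_differential br (\<lambda>zs. \<alpha> (y # x # zs)) bs"
    by (rule ce_differential_cong_scale) (use alternating_form_swap[OF \<alpha>, of "[]" _ x y] in simp)
  ultimately show ?case using *[of x y] *[of y x] by simp
next
  case (Cons a as)
  obtain M where M: "N = Suc M" using Cons.prems(2) by (cases N) auto
  have l: "length (as @ u # v # bs) = N" for u v using Cons.prems(2) by simp
  show ?case
    using Cons.IH[OF alternating_form_Cons[OF Cons.prems(1)[unfolded M], of a]]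
      derivation_swap[OF Cons.prems(1), of as bs "br a" x y] Cons.prems(2) M
      ce_differential_Cons[of "as @ x # y # bs" \<alpha> br a] ce_differential_Cons[of "as @ y # x # bs" \<alpha> br a]
      Cons.prems(1) l by simp
qed

lemma alternating_form_ce_differential:
  fixes br :: "'a::euclidean_space \<Rightarrow> 'a \<Rightarrow> 'a"
  assumes "bilinear br" and "\<And>X Y. br X Y = - br Y X" and \<alpha>: "alternating_form N \<alpha>"
  shows "alternating_form (Suc N) (ce_differential br \<alpha>)"
  unfolding alternating_form_def
proof (intro conjI allI impI)
  fix ys :: "'a list" assume "Suc (length ys) = Suc N"
  then have l: "length ys = N" by simp
  have brl: "linear (\<lambda>x. br x y)" for y using assms(1) by (simp add: bilinear_def)
  have "linear (\<lambda>x. \<alpha> (ys[j := br x (ys ! j)]))" if "j < N" for j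
    using linear_compose[OF brl alternating_form_update[OF \<alpha> l that]] by (simp add: o_def)
  then have 1: "linear (\<lambda>x. derivation (br x) \<alpha> ys)"
    unfolding derivation_def by (intro linear_compose_sum) (simp add: l)
  have "linear (\<lambda>x. (- 1) ^ (i + j) *\<^sub>R \<alpha> (x # br (ys ! i) (ys ! j) # nths ys (- {i, j})))"
    if "i < j" "j < N" for i j
    using length_nths_remove2[of i j ys] that l
    by (intro linear_compose_scale_right alternating_form_linear_Cons[OF \<alpha>]) simp
  then have 2: "linear (\<lambda>x. ce_differential br (\<lambda>Ys. \<alpha> (x # Ys)) ys)"
    unfolding ce_differential_def by (intro linear_compose_sum ballI) (simp add: l)
  show "linear (\<lambda>x. ce_differential br \<alpha> (x # ys))"
    using linear_compose_sub[OF linear_compose_neg[OF 1] 2] \<alpha> l by (simp add: ce_differential_Cons)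
next
  fix x y and as bs :: "'a list" assume "length as + length bs + 2 = Suc N"
  then show "ce_differential br \<alpha> (as @ x # y # bs) = - ce_differential br \<alpha> (as @ y # x # bs)"
    by (intro ce_differential_swap[OF assms(2) \<alpha>]) simp_all
qed

section \<open>Linear differential equations and determinants\<close>

text \<open>The terms of the Peano-Baker series: the solution of \<open>Y' = D c Y\<close> with
  initial value \<open>y\<close> is their sum over \<open>k\<close>.\<close>

primrec picard_term :: "('a \<Rightarrow> 'b \<Rightarrow> 'b) \<Rightarrow> (real \<Rightarrow> 'a) \<Rightarrow> 'b \<Rightarrow> nat \<Rightarrow> real \<Rightarrow> 'b::euclidean_space" where
  "picard_term D c y 0 = (\<lambda>t. y)"
| "picard_term D c y (Suc k) = (\<lambda>t. integral {0..t} (\<lambda>s. D (c s) (picard_term D c y k s)))"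

text \<open>The \<open>k\<close>-th term is bounded by \<open>norm y * (L * t) ^ k / fact k\<close>,
  so the series and its termwise derivative converge uniformly on the whole interval.\<close>

lemma linear_ode_exists:
  fixes D :: "'a::real_normed_vector \<Rightarrow> 'b::euclidean_space \<Rightarrow> 'b" and c :: "real \<Rightarrow> 'a"
  assumes D: "bounded_bilinear D" and c: "continuous_on {0..1} c"
  obtains Y where "Y 0 = y"
    and "\<And>t. t \<in> {0..1} \<Longrightarrow> (Y has_vector_derivative D (c t) (Y t)) (at t within {0..1})"
proof -
  interpret bounded_bilinear D by (rule D)
  obtain K where K: "\<And>a b. norm (D a b) \<le> norm a * norm b * K" "K > 0"
    using pos_bounded by blast
  obtain M where M: "\<And>t. t \<in> {0..1} \<Longrightarrow> norm (c t) \<le> M" "M > 0"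
    using compact_imp_bounded[OF compact_continuous_image[OF c compact_Icc]]
    unfolding bounded_pos by blast
  define L where "L = M * K"
  have L0: "L > 0" using K M by (simp add: L_def)
  have DL: "norm (D (c t) b) \<le> L * norm b" if "t \<in> {0..1}" for t b
  proof -
    have "norm (c t) * norm b * K \<le> M * norm b * K"
      using M(1)[OF that] K(2) by (intro mult_right_mono) auto
    then show ?thesis using K(1)[of "c t" b] by (simp add: L_def mult_ac)
  qed
  let ?\<Phi> = "picard_term D c y"
  \<comment> \<open>The termwise derivatives are the original terms under \<open>D (c t)\<close>,
    shifted by one index, so that their sum is \<open>D (c t)\<close> of the sum of the
    series.\<close>
  define \<Phi>' where "\<Phi>' = (\<lambda>k t. case k of 0 \<Rightarrow> 0 | Suc k \<Rightarrow> D (c t) (?\<Phi> k t))"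
  have cont: "continuous_on {0..1} (?\<Phi> k)"
    and deriv: "\<And>t. t \<in> {0..1} \<Longrightarrow> (?\<Phi> k has_vector_derivative \<Phi>' k t) (at t within {0..1})" for k
  proof (induction k)
    case 0
    { case 1 show ?case by simp next case 2 show ?case by (simp add: \<Phi>'_def) }
  next
    case (Suc k)
    have "continuous_on {0..1} (\<lambda>s. D (c s) (?\<Phi> k s))"
      by (intro continuous_on c Suc.IH(1))
    then have d: "(?\<Phi> (Suc k) has_vector_derivative \<Phi>' (Suc k) t) (at t within {0..1})" if "t \<in> {0..1}" for t
      unfolding \<Phi>'_def using integral_has_vector_derivative[of 0 1 _ t] that by simp
    { case 1 show ?case by (rule continuous_on_vector_derivative) (use d in blast)
      next case 2 then show ?case by (rule d) }
  qed
  have bound: "norm (?\<Phi> k t) \<le> norm y * L ^ k * t ^ k / fact k" if "t \<in> {0..1}" for k t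
    using that
  proof (induction k arbitrary: t)
    case (Suc k)
    let ?b = "\<lambda>k t. norm y * L ^ k * t ^ k / fact k"
    have FTC: "((\<lambda>s. L * ?b k s) has_integral ?b (Suc k) t - ?b (Suc k) 0) {0..t}"
    proof (rule fundamental_theorem_of_calculus)
      fix s :: real
      have "(?b (Suc k) has_real_derivative L * ?b k s) (at s within {0..t})"
        by (rule derivative_eq_intros refl | simp add: field_simps del: of_nat_Suc)+
      then show "(?b (Suc k) has_vector_derivative L * ?b k s) (at s within {0..t})"
        by (simp add: has_real_derivative_iff_has_vector_derivative)
    qed (use Suc.prems in simp)
    have sub: "{0..t} \<subseteq> {0..1}" using Suc.prems by auto
    have "norm (?\<Phi> (Suc k) t) \<le> integral {0..t} (\<lambda>s. L * ?b k s)"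
      unfolding picard_term.simps
    proof (rule integral_norm_bound_integral)
      show "(\<lambda>s. D (c s) (?\<Phi> k s)) integrable_on {0..t}"
        by (intro integrable_continuous_interval continuous_on continuous_on_subset[OF c sub]
            continuous_on_subset[OF cont sub])
      show "(\<lambda>s. L * ?b k s) integrable_on {0..t}" using FTC by blast
      fix s assume "s \<in> {0..t}"
      then have s: "s \<in> {0..1}" using sub by blast
      show "norm (D (c s) (?\<Phi> k s)) \<le> L * ?b k s"
        using DL[OF s, of "?\<Phi> k s"] mult_left_mono[OF Suc.IH[OF s], of L] L0 by linarith
    qed
    also have "\<dots> = ?b (Suc k) t" using integral_unique[OF FTC] by simp
    finally show ?case .
  qed simp
  define B where "B = (\<lambda>k. norm y * (L ^ k / fact k))"
  have sB: "summable B"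
    unfolding B_def using summable_exp[of L] by (intro summable_mult) (simp add: divide_inverse mult.commute)
  have \<Phi>B: "norm (?\<Phi> k t) \<le> B k" if "t \<in> {0..1}" for k t
  proof -
    have "norm y * L ^ k * t ^ k / fact k \<le> norm y * L ^ k * 1 / fact k"
      using that L0 by (intro divide_right_mono mult_left_mono power_le_one) auto
    then show ?thesis using bound[OF that, of k] by (simp add: B_def)
  qed
  have s\<Phi>: "summable (\<lambda>k. ?\<Phi> k t)" if "t \<in> {0..1}" for t
    by (rule summable_comparison_test[OF _ sB]) (use \<Phi>B[OF that] in auto)
  define M' where "M' = (\<lambda>k. case k of 0 \<Rightarrow> 0 | Suc k \<Rightarrow> L * B k)"
  have sM: "summable M'"
    using summable_mult[OF sB, of L] summable_Suc_iff[of M'] by (simp add: M'_def)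
  have \<Phi>'M: "norm (\<Phi>' k t) \<le> M' k" if "t \<in> {0..1}" for k t
  proof (cases k)
    case (Suc m)
    have "norm (D (c t) (?\<Phi> m t)) \<le> L * B m"
      using DL[OF that, of "?\<Phi> m t"] mult_left_mono[OF \<Phi>B[OF that, of m], of L] L0 by linarith
    then show ?thesis by (simp add: Suc \<Phi>'_def M'_def)
  qed (simp add: \<Phi>'_def M'_def)
  define G where "G = (\<lambda>t. \<Sum>k. \<Phi>' k t)"
  have G: "G t = D (c t) (\<Sum>k. ?\<Phi> k t)" if "t \<in> {0..1}" for t
  proof -
    have "summable (\<lambda>k. \<Phi>' k t)"
      by (rule summable_comparison_test[OF _ sM]) (use \<Phi>'M[OF that] in auto)
    moreover have "\<Phi>' 0 t = 0" by (simp add: \<Phi>'_def)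
    ultimately have "G t = (\<Sum>k. \<Phi>' (Suc k) t)"
      using suminf_split_head[of "\<lambda>k. \<Phi>' k t"] by (simp add: G_def)
    also have "\<dots> = D (c t) (\<Sum>k. ?\<Phi> k t)"
      using bounded_linear.suminf[OF bounded_linear_right s\<Phi>[OF that], of "c t"] by (simp add: \<Phi>'_def)
    finally show ?thesis .
  qed
  have ul: "uniform_limit {0..1} (\<lambda>n t. \<Sum>k<n. \<Phi>' k t) G sequentially"
    unfolding G_def by (rule Weierstrass_m_test[OF \<Phi>'M sM])
  have "\<exists>g. \<forall>t\<in>{0..1}. (\<lambda>k. ?\<Phi> k t) sums g t \<and> (g has_derivative (\<lambda>h. h *\<^sub>R G t)) (at t within {0..1})"
  proof (rule has_derivative_series)
    show "convex {0..1::real}" by simp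
    show "(?\<Phi> n has_derivative (\<lambda>h. h *\<^sub>R \<Phi>' n t)) (at t within {0..1})" if "t \<in> {0..1}" for n t
      using deriv[OF that] by (simp add: has_vector_derivative_def)
    show "\<forall>\<^sub>F n in sequentially. \<forall>t\<in>{0..1}. \<forall>h. norm ((\<Sum>i<n. h *\<^sub>R \<Phi>' i t) - h *\<^sub>R G t) \<le> e * norm h"
      if "e > 0" for e
      using uniform_limitD[OF ul that]
    proof eventually_elim
      case (elim n)
      show ?case
      proof (intro ballI allI)
        fix t h :: real assume "t \<in> {0..1}"
        then have "norm ((\<Sum>i<n. \<Phi>' i t) - G t) \<le> e" using elim by (simp add: dist_norm less_imp_le)
        then have "\<bar>h\<bar> * norm ((\<Sum>i<n. \<Phi>' i t) - G t) \<le> \<bar>h\<bar> * e" by (rule mult_left_mono) simp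
        moreover have "(\<Sum>i<n. h *\<^sub>R \<Phi>' i t) - h *\<^sub>R G t = h *\<^sub>R ((\<Sum>i<n. \<Phi>' i t) - G t)"
          by (simp add: scaleR_sum_right scaleR_diff_right)
        ultimately show "norm ((\<Sum>i<n. h *\<^sub>R \<Phi>' i t) - h *\<^sub>R G t) \<le> e * norm h"
          by (simp add: mult.commute)
      qed
    qed
    show "(0::real) \<in> {0..1}" by simp
    show "(\<lambda>k. ?\<Phi> k 0) sums (\<Sum>k. ?\<Phi> k 0)" by (intro summable_sums s\<Phi>) simp
  qed
  then obtain Y where "\<forall>t\<in>{0..1}. (\<lambda>k. ?\<Phi> k t) sums Y t \<and> (Y has_derivative (\<lambda>h. h *\<^sub>R G t)) (at t within {0..1})"
    by blast
  then have Y: "\<And>t. t \<in> {0..1} \<Longrightarrow> (\<lambda>k. ?\<Phi> k t) sums Y t"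
      "\<And>t. t \<in> {0..1} \<Longrightarrow> (Y has_vector_derivative G t) (at t within {0..1})"
    unfolding has_vector_derivative_def by blast+
  show ?thesis
  proof
    have "?\<Phi> k 0 = (if k = 0 then y else 0)" for k by (cases k) auto
    then have "(\<lambda>k. ?\<Phi> k 0) sums y" using sums_single[of 0 "\<lambda>_. y"] by simp
    then show "Y 0 = y" using Y(1)[of 0] by (simp add: sums_unique2)
    show "(Y has_vector_derivative D (c t) (Y t)) (at t within {0..1})" if "t \<in> {0..1}" for t
      using Y(2)[OF that] G[OF that] sums_unique[OF Y(1)[OF that]] by simp
  qed
qed

text \<open>Jacobi's formula for \<open>U' = N U\<close>. The product rule differentiates one row at
  a time; row \<open>r\<close> of \<open>N ** U x\<close> is a combination of the rows of
  \<open>U x\<close>, and only the multiple of row \<open>r\<close> itself contributes to the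
  determinant.\<close>

lemma det_has_vector_derivative:
  fixes U :: "real \<Rightarrow> complex^'n^'n"
  assumes "\<And>i j. ((\<lambda>t. U t $ i $ j) has_vector_derivative (N ** U x) $ i $ j) (at x within S)"
  shows "((\<lambda>t. det (U t)) has_vector_derivative trace N * det (U x)) (at x within S)"
proof -
  let ?P = "{p. p permutes (UNIV :: 'n set)}"
  let ?R = "\<lambda>r. \<chi> i. if i = r then row r (N ** U x) else row i (U x)"
  have "((\<lambda>t. \<Sum>p\<in>?P. of_int (sign p) * (\<Prod>i\<in>UNIV. U t $ i $ p i)) has_vector_derivative
     (\<Sum>p\<in>?P. of_int (sign p) * (\<Sum>r\<in>UNIV. (N ** U x) $ r $ p r * (\<Prod>i\<in>UNIV - {r}. U x $ i $ p i)))) (at x within S)"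
  proof (intro has_vector_derivative_sum has_vector_derivative_mult_right)
    fix p
    have "((\<lambda>t. \<Prod>i\<in>UNIV. U t $ i $ p i) has_derivative
       (\<lambda>h. \<Sum>r\<in>UNIV. (h *\<^sub>R (N ** U x) $ r $ p r) * (\<Prod>i\<in>UNIV - {r}. U x $ i $ p i))) (at x within S)"
      using assms by (intro has_derivative_prod) (simp add: has_vector_derivative_def)
    then show "((\<lambda>t. \<Prod>i\<in>UNIV. U t $ i $ p i) has_vector_derivative
      (\<Sum>r\<in>UNIV. (N ** U x) $ r $ p r * (\<Prod>i\<in>UNIV - {r}. U x $ i $ p i))) (at x within S)"
      by (simp add: has_vector_derivative_def scaleR_sum_right)
  qed
  moreover have "(\<Sum>p\<in>?P. of_int (sign p) * (\<Sum>r\<in>UNIV. (N ** U x) $ r $ p r * (\<Prod>i\<in>UNIV - {r}. U x $ i $ p i)))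
      = (\<Sum>r\<in>UNIV. det (?R r))"
  proof -
    have "(\<Prod>i\<in>UNIV. ?R r $ i $ p i) = (N ** U x) $ r $ p r * (\<Prod>i\<in>UNIV - {r}. U x $ i $ p i)" for r p
      by (subst prod.remove[of _ r]) (auto simp: row_def intro!: prod.cong)
    then show ?thesis
      unfolding det_def sum_distrib_left by (subst sum.swap) simp
  qed
  moreover have "det (?R r) = N $ r $ r * det (U x)" for r
  proof -
    have *: "row r (N ** U x) = (\<Sum>k\<in>UNIV. N $ r $ k *s row k (U x))"
      by (simp add: vec_eq_iff row_def matrix_matrix_mult_def)
    have "det (?R r) = (\<Sum>k\<in>UNIV. det (\<chi> i. if i = r then N $ r $ k *s row k (U x) else row i (U x)))"
      unfolding * by (rule det_linear_row_sum[OF finite])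
    also have "\<dots> = (\<Sum>k\<in>UNIV. N $ r $ k * (if k = r then det (U x) else 0))"
    proof (intro sum.cong refl)
      fix k
      have "det (\<chi> i. if i = r then row k (U x) else row i (U x)) = (if k = r then det (U x) else 0)"
      proof (cases "k = r")
        case True
        then have "(\<chi> i. if i = r then row k (U x) else row i (U x)) = U x"
          by (simp add: vec_eq_iff row_def)
        then show ?thesis using True by simp
      next
        case False
        then show ?thesis
          using det_identical_rows[of k r "\<chi> i. if i = r then row k (U x) else row i (U x)"]
          by (simp add: row_def vec_eq_iff)
      qed
      then show "det (\<chi> i. if i = r then N $ r $ k *s row k (U x) else row i (U x)) =
          N $ r $ k * (if k = r then det (U x) else 0)"
        by (simp add: det_row_mul)
    qed
    also have "\<dots> = N $ r $ r * det (U x)" by (simp add: if_distrib sum.delta cong: if_cong)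
    finally show ?thesis .
  qed
  ultimately show ?thesis
    unfolding det_def[symmetric] by (simp add: trace_def sum_distrib_right)
qed

section \<open>Hermitian vector spaces\<close>

locale hermitian_space =
  fixes J :: "'a::euclidean_space \<Rightarrow> 'a" and g :: "'a \<Rightarrow> 'a \<Rightarrow> real"
  assumes linear_J: "linear J" and J_J [simp]: "J (J x) = - x"
    and inner_product_g: "inner_product g" and g_J_J: "g (J x) (J y) = g x y"
begin

lemma bilinear_g: "bilinear g"
  using inner_product_g by (simp add: inner_product_def)

lemma bounded_bilinear_g: "bounded_bilinear g"
  using bilinear_g bilinear_conv_bounded_bilinear by blast

lemma g_sym: "g x y = g y x"
  using inner_product_g by (auto simp: inner_product_def)

lemma g_eq_0_iff [simp]: "g x x = 0 \<longleftrightarrow> x = 0"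
proof
  show "g x x = 0 \<Longrightarrow> x = 0" using inner_product_g unfolding inner_product_def by force
qed (simp add: bounded_bilinear.zero_left[OF bounded_bilinear_g])

lemma g_nonneg: "0 \<le> g x x"
  using inner_product_g g_eq_0_iff[of x] unfolding inner_product_def by (metis less_eq_real_def)

lemma linear_g_left: "linear (\<lambda>x. g x y)" and linear_g_right: "linear (g x)"
  using bilinear_g by (auto simp: bilinear_def)

lemmas g_simps [simp] =
  linear_add[OF linear_g_left] linear_add[OF linear_g_right]
  linear_diff[OF linear_g_left] linear_diff[OF linear_g_right]
  linear_neg[OF linear_g_left] linear_neg[OF linear_g_right]
  linear_0[OF linear_g_left] linear_0[OF linear_g_right]
  linear_cmul[OF linear_g_left] linear_cmul[OF linear_g_right]
  linear_sum[OF linear_g_left] linear_sum[OF linear_g_right]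

lemmas J_simps [simp] =
  linear_add[OF linear_J] linear_diff[OF linear_J] linear_neg[OF linear_J] linear_0[OF linear_J]
  linear_cmul[OF linear_J] linear_sum[OF linear_J]

lemma g_J_left [simp]: "g (J x) y = - g x (J y)"
proof -
  have "g (J x) (- y) = g x (J y)" using g_J_J[of x "J y"] by (simp only: J_J)
  then have "- g (J x) y = g x (J y)" by (simp only: g_simps)
  then show ?thesis by linarith
qed

lemma g_J_self [simp]: "g x (J x) = 0"
  using g_J_left[of x x] g_sym[of x "J x"] by linarith

lemma eq_if_g_eq: "(\<And>z. g x z = g y z) \<Longrightarrow> x = y"
  using g_eq_0_iff[of "x - y"] by (simp del: g_eq_0_iff)

text \<open>Orthonormality over the complex numbers. In contrast to \<open>unitary_frame\<close>,
  spanning is not demanded, so that such sets can be extended step by step.\<close>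

definition unitary_set :: "'a set \<Rightarrow> bool" where
  "unitary_set F \<longleftrightarrow> finite F \<and> (\<forall>x\<in>F. \<forall>y\<in>F. g x y = (if x = y then 1 else 0) \<and> g x (J y) = 0)"

lemma unitary_setD:
  assumes "unitary_set F"
  shows "finite F" and "x \<in> F \<Longrightarrow> y \<in> F \<Longrightarrow> g x y = (if x = y then 1 else 0)"
    and "x \<in> F \<Longrightarrow> y \<in> F \<Longrightarrow> g x (J y) = 0"
  using assms unfolding unitary_set_def by blast+

lemma orthonormal_independent:
  assumes "\<And>x y. x \<in> S \<Longrightarrow> y \<in> S \<Longrightarrow> g x y = (if x = y then 1 else 0)"
  shows "independent S"
  unfolding dependent_def
proof
  assume "\<exists>a\<in>S. a \<in> span (S - {a})"
  then obtain a where a: "a \<in> S" "a \<in> span (S - {a})" by blast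
  have "g a a = 0"
    by (rule linear_eq_0_on_span[OF linear_g_right _ a(2)]) (use assms a in auto)
  then show False using assms[OF a(1) a(1)] by simp
qed

lemma unitary_set_J_disjoint:
  assumes "unitary_set F"
  shows "F \<inter> J ` F = {}" and "inj_on J F"
proof -
  show "inj_on J F" by (metis J_J inj_onI neg_equal_iff_equal)
  show "F \<inter> J ` F = {}"
  proof (rule ccontr)
    assume "F \<inter> J ` F \<noteq> {}"
    then obtain x y where "x \<in> F" "y \<in> F" "x = J y" by blast
    then have "g x x = 0" using unitary_setD(3)[OF assms, of x y] by simp
    then show False using unitary_setD(2)[OF assms \<open>x \<in> F\<close> \<open>x \<in> F\<close>] by simp
  qed
qed

text \<open>Together with its image under \<open>J\<close> the set is orthonormal, hence
  independent.\<close>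

lemma unitary_set_card_le:
  assumes "unitary_set F"
  shows "2 * card F \<le> DIM('a)"
proof -
  have "independent (F \<union> J ` F)"
  proof (rule orthonormal_independent)
    fix x y assume "x \<in> F \<union> J ` F" "y \<in> F \<union> J ` F"
    moreover have "J a = J b \<longleftrightarrow> a = b" for a b by (metis J_J neg_equal_iff_equal)
    moreover have "a \<noteq> J b" if "a \<in> F" "b \<in> F" for a b
      using unitary_set_J_disjoint(1)[OF assms] that by blast
    ultimately show "g x y = (if x = y then 1 else 0)"
      using unitary_setD(2,3)[OF assms] by (auto split: if_splits)
  qed
  then have "card (F \<union> J ` F) \<le> DIM('a)"
    using independent_card_le_dim[of "F \<union> J ` F" UNIV] by simp
  then show ?thesis
    using unitary_set_J_disjoint[OF assms] unitary_setD(1)[OF assms]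
    by (simp add: card_Un_disjoint card_image)
qed

lemma g_unitary_sum:
  assumes F: "unitary_set F" and f: "f \<in> F"
  shows "g (\<Sum>x\<in>F. a x *\<^sub>R x + b x *\<^sub>R J x) f = a f" and "g (\<Sum>x\<in>F. a x *\<^sub>R x + b x *\<^sub>R J x) (J f) = b f"
proof -
  have "g (\<Sum>x\<in>F. a x *\<^sub>R x + b x *\<^sub>R J x) f = (\<Sum>x\<in>F. if x = f then a x else 0)"
    unfolding linear_sum[OF linear_g_left] by (intro sum.cong refl) (use unitary_setD[OF F] f in simp)
  then show "g (\<Sum>x\<in>F. a x *\<^sub>R x + b x *\<^sub>R J x) f = a f"
    using unitary_setD(1)[OF F] f by simp
  have "g (\<Sum>x\<in>F. a x *\<^sub>R x + b x *\<^sub>R J x) (J f) = (\<Sum>x\<in>F. if x = f then b x else 0)"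
    unfolding linear_sum[OF linear_g_left] by (intro sum.cong refl) (use unitary_setD[OF F] f in simp)
  then show "g (\<Sum>x\<in>F. a x *\<^sub>R x + b x *\<^sub>R J x) (J f) = b f"
    using unitary_setD(1)[OF F] f by simp
qed

text \<open>One step of the Gram-Schmidt process: the projection to the complex span is subtracted
  from a vector outside it, and the rest is normalized.\<close>

lemma unitary_set_extend:
  assumes F: "unitary_set F" and "span (F \<union> J ` F) \<noteq> UNIV"
  shows "\<exists>f. f \<notin> F \<and> unitary_set (insert f F)"
proof -
  obtain x where x: "x \<notin> span (F \<union> J ` F)" using assms(2) by blast
  define p where "p = (\<Sum>f\<in>F. g x f *\<^sub>R f + g x (J f) *\<^sub>R J f)"
  define y where "y = x - p"
  have "p \<in> span (F \<union> J ` F)"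
    unfolding p_def by (intro span_sum span_add span_scale span_base) auto
  then have "y \<noteq> 0" using x by (auto simp: y_def)
  then have y0: "g y y > 0" using \<open>y \<noteq> 0\<close> g_nonneg[of y] g_eq_0_iff[of y] by (metis less_eq_real_def)
  have orth: "g y f = 0" "g y (J f) = 0" if "f \<in> F" for f
    using g_unitary_sum[OF F that, of "g x" "\<lambda>f. g x (J f)"] by (simp_all add: y_def p_def del: linear_sum[OF linear_g_left])
  define f where "f = (1 / sqrt (g y y)) *\<^sub>R y"
  have ff: "g f f = 1" using y0 \<open>y \<noteq> 0\<close> by (simp add: f_def)
  have fo: "g f h = 0" "g f (J h) = 0" if "h \<in> F" for h
    using orth[OF that] by (simp_all add: f_def)
  have of: "g h f = 0" "g h (J f) = 0" if "h \<in> F" for h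
    using fo[OF that] g_sym[of h f] g_sym[of h "J f"] by simp_all
  have "f \<notin> F" using fo(1)[of f] ff by auto
  moreover have "unitary_set (insert f F)"
    using unitary_setD[OF F] ff fo of \<open>f \<notin> F\<close> unfolding unitary_set_def by auto
  ultimately show ?thesis by blast
qed

lemma unitary_set_complete:
  assumes "unitary_set F"
  obtains F' where "F \<subseteq> F'" "unitary_set F'" "span (F' \<union> J ` F') = UNIV" "2 * card F' = DIM('a)"
proof -
  have "\<exists>F'. F \<subseteq> F' \<and> unitary_set F' \<and> span (F' \<union> J ` F') = UNIV"
    using assms
  proof (induction "DIM('a) - card F" arbitrary: F rule: less_induct)
    case less
    show ?case
    proof (cases "span (F \<union> J ` F) = UNIV")
      case False
      then obtain f where f: "f \<notin> F" "unitary_set (insert f F)"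
        using unitary_set_extend[OF less.prems] by blast
      then have "card (insert f F) = Suc (card F)" using unitary_setD(1)[OF less.prems] by simp
      then have "DIM('a) - card (insert f F) < DIM('a) - card F"
        using unitary_set_card_le[OF f(2)] by simp
      then show ?thesis using less.hyps[OF _ f(2)] by blast
    qed (use less.prems in blast)
  qed
  then obtain F' where F': "F \<subseteq> F'" "unitary_set F'" "span (F' \<union> J ` F') = UNIV" by blast
  have "DIM('a) \<le> card (F' \<union> J ` F')"
    using dim_le_card[of UNIV "F' \<union> J ` F'"] F'(3) unitary_setD(1)[OF F'(2)] by simp
  also have "\<dots> = 2 * card F'"
    using unitary_set_J_disjoint[OF F'(2)] unitary_setD(1)[OF F'(2)] by (simp add: card_Un_disjoint card_image)
  finally have "2 * card F' = DIM('a)" using unitary_set_card_le[OF F'(2)] by simp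
  then show ?thesis using that F' by blast
qed

lemma unitary_basis_exists:
  obtains F where "unitary_set F" "span (F \<union> J ` F) = UNIV" "2 * card F = DIM('a)"
proof -
  have "unitary_set {}" by (simp add: unitary_set_def)
  then show ?thesis using unitary_set_complete that by metis
qed

lemma unitary_expansion:
  assumes F: "unitary_set F" and S: "span (F \<union> J ` F) = UNIV"
  shows "x = (\<Sum>f\<in>F. g x f *\<^sub>R f + g x (J f) *\<^sub>R J f)" (is "_ = ?p")
proof -
  have "g (x - ?p) (x - ?p) = 0"
  proof (rule linear_eq_0_on_span[OF linear_g_right])
    show "x - ?p \<in> span (F \<union> J ` F)" using S by simp
    show "g (x - ?p) z = 0" if "z \<in> F \<union> J ` F" for z
      using that g_unitary_sum[OF F, of _ "g x" "\<lambda>f. g x (J f)"] by (auto simp del: linear_sum[OF linear_g_left])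
  qed
  then show ?thesis by (simp del: g_simps)
qed

text \<open>The trace does not depend on the basis: \<open>T b\<close> is expanded in the unitary
  basis, the sums are interchanged, and the sum over \<open>Basis\<close> is then the expansion of
  the basis vectors.\<close>

lemma endo_trace_unitary:
  assumes F: "unitary_set F" and S: "span (F \<union> J ` F) = UNIV" and T: "linear T"
  shows "endo_trace T = (\<Sum>f\<in>F. g (T f) f + g (T (J f)) (J f))"
proof -
  have "endo_trace T = (\<Sum>b\<in>Basis. (\<Sum>f\<in>F. g (T b) f *\<^sub>R f + g (T b) (J f) *\<^sub>R J f) \<bullet> b)"
    unfolding endo_trace_def using unitary_expansion[OF F S] by simp
  also have "\<dots> = (\<Sum>b\<in>Basis. \<Sum>f\<in>F. g (T b) f * (f \<bullet> b) + g (T b) (J f) * (J f \<bullet> b))"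
    by (simp add: inner_sum_left inner_add_left)
  also have "\<dots> = (\<Sum>f\<in>F. \<Sum>b\<in>Basis. g (T b) f * (f \<bullet> b) + g (T b) (J f) * (J f \<bullet> b))"
    by (rule sum.swap)
  also have "\<dots> = (\<Sum>f\<in>F. g (T f) f + g (T (J f)) (J f))"
  proof (intro sum.cong refl)
    fix f assume "f \<in> F"
    have *: "(\<Sum>b\<in>Basis. g (T b) w * (h \<bullet> b)) = g (T h) w" for w h
    proof -
      have "g (T (\<Sum>b\<in>Basis. (h \<bullet> b) *\<^sub>R b)) w = (\<Sum>b\<in>Basis. g (T b) w * (h \<bullet> b))"
        by (simp add: linear_sum[OF T] linear_cmul[OF T] mult.commute)
      then show ?thesis by (simp add: euclidean_representation)
    qed
    show "(\<Sum>b\<in>Basis. g (T b) f * (f \<bullet> b) + g (T b) (J f) * (J f \<bullet> b)) = g (T f) f + g (T (J f)) (J f)"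
      unfolding sum.distrib * ..
  qed
  finally show ?thesis .
qed

text \<open>The coefficients of \<open>w\<close> are the values of \<phi> on a unitary basis. This
  makes the definite descriptions of the Levi-Civita and Bismut connections meaningful.\<close>

lemma riesz:
  assumes "linear \<phi>"
  shows "\<exists>!w. \<forall>z. g w z = \<phi> z"
proof -
  obtain F where F: "unitary_set F" and S: "span (F \<union> J ` F) = UNIV"
    by (rule unitary_basis_exists)
  let ?w = "\<Sum>f\<in>F. \<phi> f *\<^sub>R f + \<phi> (J f) *\<^sub>R J f"
  have "g ?w z = \<phi> z" for z
  proof -
    have "g ?w z = (\<Sum>f\<in>F. \<phi> f * g f z + \<phi> (J f) * g (J f) z)"
      by (simp del: g_J_left)
    also have "\<dots> = (\<Sum>f\<in>F. g z f * \<phi> f + g z (J f) * \<phi> (J f))"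
      by (intro sum.cong refl) (simp only: g_sym[of z] mult.commute)
    also have "\<dots> = \<phi> (\<Sum>f\<in>F. g z f *\<^sub>R f + g z (J f) *\<^sub>R J f)"
      using assms by (simp add: linear_sum linear_add linear_cmul)
    finally show ?thesis using unitary_expansion[OF F S, of z] by simp
  qed
  then show ?thesis by (intro ex1I[of _ ?w]) (auto intro: eq_if_g_eq)
qed

section \<open>Unitary frames and complex matrices\<close>

lemma unitary_frame_set:
  fixes e :: "'n::finite \<Rightarrow> 'a"
  assumes "unitary_frame J g e"
  shows "inj e" and "unitary_set (range e)" and "span (range e \<union> J ` range e) = UNIV"
proof -
  have e: "g (e i) (e j) = (if i = j then 1 else 0)" "g (e i) (J (e j)) = 0" for i j
    using assms by (auto simp: unitary_frame_def)
  show "inj e" using e(1) by (metis injI zero_neq_one)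
  then show "unitary_set (range e)" unfolding unitary_set_def using e by (auto simp: inj_eq)
  show "span (range e \<union> J ` range e) = UNIV" using assms by (simp add: unitary_frame_def image_comp)
qed

lemma unitary_frame_exists:
  assumes "DIM('a) = 2 * CARD('n::finite)"
  obtains e :: "'n::finite \<Rightarrow> 'a" where "unitary_frame J g e"
proof -
  obtain F where F: "unitary_set F" "span (F \<union> J ` F) = UNIV" "2 * card F = DIM('a)"
    by (rule unitary_basis_exists)
  have "card (UNIV :: 'n set) = card F" using F(3) assms by simp
  then obtain e :: "'n \<Rightarrow> 'a" where e: "bij_betw e UNIV F"
    using finite_same_card_bij[of "UNIV :: 'n set" F] unitary_setD(1)[OF F(1)] by auto
  then have r: "range e = F" "inj e" by (auto simp: bij_betw_def)
  then have "e i \<in> F" for i by auto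
  then have "unitary_frame J g e"
    unfolding unitary_frame_def image_comp[symmetric] using unitary_setD(2,3)[OF F(1)] r F(2)
    by (auto simp: inj_eq simp del: image_comp)
  then show ?thesis by (rule that)
qed

lemma unitary_frame_expansion:
  fixes e :: "'n::finite \<Rightarrow> 'a"
  assumes "unitary_frame J g e"
  shows "x = (\<Sum>i\<in>UNIV. g x (e i) *\<^sub>R e i + g x (J (e i)) *\<^sub>R J (e i))"
  using unitary_expansion[OF unitary_frame_set(2,3)[OF assms], of x] unitary_frame_set(1)[OF assms]
  by (simp add: sum.reindex)

lemma endo_trace_unitary_frame:
  fixes e :: "'n::finite \<Rightarrow> 'a"
  assumes "unitary_frame J g e" and "linear T"
  shows "endo_trace T = (\<Sum>i\<in>UNIV. g (T (e i)) (e i) + g (T (J (e i))) (J (e i)))"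
  using endo_trace_unitary[OF unitary_frame_set(2,3)[OF assms(1)] assms(2)] unitary_frame_set(1)[OF assms(1)]
  by (simp add: sum.reindex)

text \<open>Complex linearity of \<open>P\<close> turns the expansion of \<open>Q (e j)\<close> into
  the complex matrix product; the two real identities are its real and imaginary parts.\<close>

lemma frame_matrix_compose:
  fixes e :: "'n::finite \<Rightarrow> 'a"
  assumes e: "unitary_frame J g e" and P: "linear P" "\<And>x. P (J x) = J (P x)"
  shows "frame_matrix J g e (\<lambda>x. P (Q x)) = frame_matrix J g e P ** frame_matrix J g e Q"
proof -
  have "g (P (Q (e j))) (e i) = (\<Sum>k\<in>UNIV. g (P (e k)) (e i) * g (Q (e j)) (e k) - g (P (e k)) (J (e i)) * g (Q (e j)) (J (e k)))"
    and "g (P (Q (e j))) (J (e i)) = (\<Sum>k\<in>UNIV. g (P (e k)) (e i) * g (Q (e j)) (J (e k)) + g (P (e k)) (J (e i)) * g (Q (e j)) (e k))"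
    for i j
    by (subst unitary_frame_expansion[OF e, of "Q (e j)"],
        simp add: linear_sum[OF P(1)] linear_add[OF P(1)] linear_cmul[OF P(1)] P(2) algebra_simps)+
  then show ?thesis
    by (simp add: frame_matrix_def matrix_matrix_mult_def vec_eq_iff complex_eq_iff)
qed

lemma frame_matrix_id:
  fixes e :: "'n::finite \<Rightarrow> 'a"
  assumes "unitary_frame J g e"
  shows "frame_matrix J g e (\<lambda>x. x) = mat 1"
  using assms by (auto simp: frame_matrix_def unitary_frame_def vec_eq_iff mat_def complex_eq_iff)

text \<open>By Parseval's identity, the conjugate transpose times the matrix has the Hermitian
  products of the vectors \<open>P (e i)\<close> as entries; for square matrices a left inverse is
  also a right inverse.\<close>

lemma frame_matrix_unitary:
  fixes e :: "'n::finite \<Rightarrow> 'a"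
  assumes e: "unitary_frame J g e" and P: "\<And>x. P (J x) = J (P x)" "\<And>x y. g (P x) (P y) = g x y"
  shows "frame_matrix J g e P ** map_matrix cnj (transpose (frame_matrix J g e P)) = mat 1"
proof -
  let ?U = "frame_matrix J g e P"
  have ge: "g (e i) (e j) = (if i = j then 1 else 0)" "g (e i) (J (e j)) = 0" for i j
    using e by (auto simp: unitary_frame_def)
  have 1: "(\<Sum>k\<in>UNIV. g x (e k) * g y (e k) + g x (J (e k)) * g y (J (e k))) = g x y" for x y
    by (subst (3) unitary_frame_expansion[OF e, of y]) (simp add: mult.commute)
  have 2: "(\<Sum>k\<in>UNIV. g x (J (e k)) * g y (e k) - g x (e k) * g y (J (e k))) = g x (J y)" for x y
    by (subst (3) unitary_frame_expansion[OF e, of y]) (simp add: mult.commute)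
  have "map_matrix cnj (transpose ?U) ** ?U = mat 1"
  proof -
    have "(map_matrix cnj (transpose ?U) ** ?U) $ i $ j = mat 1 $ i $ j" for i j
    proof -
      have "(map_matrix cnj (transpose ?U) ** ?U) $ i $ j =
        Complex (\<Sum>k\<in>UNIV. g (P (e j)) (e k) * g (P (e i)) (e k) + g (P (e j)) (J (e k)) * g (P (e i)) (J (e k)))
          (\<Sum>k\<in>UNIV. g (P (e j)) (J (e k)) * g (P (e i)) (e k) - g (P (e j)) (e k) * g (P (e i)) (J (e k)))"
        by (simp add: matrix_matrix_mult_def map_matrix_def transpose_def frame_matrix_def complex_eq_iff mult.commute
            add.commute)
      also have "\<dots> = Complex (g (e j) (e i)) (g (e j) (J (e i)))"
        unfolding 1 2 P(1)[symmetric] P(2) ..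
      also have "\<dots> = mat 1 $ i $ j" by (auto simp: ge mat_def complex_eq_iff)
      finally show ?thesis .
    qed
    then show ?thesis by (simp add: vec_eq_iff)
  qed
  then show ?thesis using matrix_left_right_inverse by blast
qed

end

section \<open>Parallel transport and holonomy\<close>

locale hermitian_connection = hermitian_space J g
  for J :: "'a::euclidean_space \<Rightarrow> 'a" and g :: "'a \<Rightarrow> 'a \<Rightarrow> real" +
  fixes D :: "'a \<Rightarrow> 'a \<Rightarrow> 'a"
  assumes bilinear_D: "bilinear D"
    and D_skew: "g (D X Y) Z = - g Y (D X Z)"
    and D_J: "D X (J Y) = J (D X Y)"
begin

text \<open>The complex trace of the skew-Hermitian endomorphism \<open>D X\<close> is \<i> times
  this real number.\<close>

definition connection_trace :: "('n::finite \<Rightarrow> 'a) \<Rightarrow> 'a \<Rightarrow> real" where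
  "connection_trace e X = (\<Sum>i\<in>UNIV. g (D X (e i)) (J (e i)))"

lemma linear_D_left: "linear (\<lambda>X. D X Y)" and linear_D: "linear (D X)"
  using bilinear_D by (auto simp: bilinear_def)

lemma linear_connection_trace: "linear (connection_trace e)"
  unfolding connection_trace_def
  by (intro linear_compose_sum ballI linear_compose[OF linear_D_left linear_g_left, unfolded o_def])

lemma g_parallel_constant:
  assumes "\<And>t. t \<in> {0..1} \<Longrightarrow> (V has_vector_derivative - D (c t) (V t)) (at t within {0..1})"
    and "\<And>t. t \<in> {0..1} \<Longrightarrow> (W has_vector_derivative - D (c t) (W t)) (at t within {0..1})"
    and t: "t \<in> {0..1}"
  shows "g (V t) (W t) = g (V 0) (W 0)"
proof -
  have "((\<lambda>t. g (V t) (W t)) has_vector_derivative 0) (at t within {0..1})" if "t \<in> {0..1}" for t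
    using bounded_bilinear.has_vector_derivative[OF bounded_bilinear_g assms(1)[OF that] assms(2)[OF that]]
      D_skew[of "c t" "V t" "W t"] by simp
  then obtain k where "\<And>t. t \<in> {0..1} \<Longrightarrow> g (V t) (W t) = k"
    using has_vector_derivative_zero_constant[of "{0..1}" "\<lambda>t. g (V t) (W t)"] by auto
  then show ?thesis using t by simp
qed

text \<open>The difference of two parallel fields is parallel, so its norm is constant.\<close>

lemma parallel_unique:
  assumes V: "\<And>t. t \<in> {0..1} \<Longrightarrow> (V has_vector_derivative - D (c t) (V t)) (at t within {0..1})"
    and W: "\<And>t. t \<in> {0..1} \<Longrightarrow> (W has_vector_derivative - D (c t) (W t)) (at t within {0..1})"
    and "V 0 = W 0" and t: "t \<in> {0..1}"
  shows "V t = W t"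
proof -
  have "((\<lambda>t. V t - W t) has_vector_derivative - D (c t) (V t - W t)) (at t within {0..1})" if "t \<in> {0..1}" for t
    using has_vector_derivative_diff[OF V[OF that] W[OF that]] by (simp add: linear_diff[OF linear_D])
  from g_parallel_constant[OF this this t] have "g (V t - W t) (V t - W t) = 0"
    using assms(3) by (simp del: g_eq_0_iff)
  then show ?thesis unfolding g_eq_0_iff by simp
qed

context
  fixes c :: "real \<Rightarrow> 'a" and F :: "real \<Rightarrow> 'a \<Rightarrow> 'a"
  assumes F: "parallel_transport D c F"
begin

lemma parallel_transport_0: "F 0 y = y"
  using F by (simp add: parallel_transport_def)

lemma parallel_transport_deriv:
  "t \<in> {0..1} \<Longrightarrow> ((\<lambda>t. F t y) has_vector_derivative - D (c t) (F t y)) (at t within {0..1})"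
  using F by (simp add: parallel_transport_def)

lemma parallel_transport_g:
  "t \<in> {0..1} \<Longrightarrow> g (F t x) (F t y) = g x y"
  using g_parallel_constant[of "\<lambda>t. F t x" c "\<lambda>t. F t y" t] parallel_transport_deriv
  by (simp add: parallel_transport_0)

lemma parallel_transport_linear:
  assumes t: "t \<in> {0..1}"
  shows "linear (F t)"
proof
  fix x y and r :: real
  have "((\<lambda>t. F t x + F t y) has_vector_derivative - D (c t) (F t x + F t y)) (at t within {0..1})" if "t \<in> {0..1}" for t
    using has_vector_derivative_add[OF parallel_transport_deriv[OF that, of x] parallel_transport_deriv[OF that, of y]]
    by (simp add: linear_add[OF linear_D])
  then show "F t (x + y) = F t x + F t y"
    using parallel_unique[of "\<lambda>t. F t (x + y)" c "\<lambda>t. F t x + F t y", OF parallel_transport_deriv _ _ t]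
    by (simp add: parallel_transport_0)
  have "((\<lambda>t. r *\<^sub>R F t x) has_vector_derivative - D (c t) (r *\<^sub>R F t x)) (at t within {0..1})" if "t \<in> {0..1}" for t
    using bounded_linear.has_vector_derivative[OF bounded_linear_scaleR_right parallel_transport_deriv[OF that, of x], of r]
    by (simp add: linear_cmul[OF linear_D])
  then show "F t (r *\<^sub>R x) = r *\<^sub>R F t x"
    using parallel_unique[of "\<lambda>t. F t (r *\<^sub>R x)" c "\<lambda>t. r *\<^sub>R F t x", OF parallel_transport_deriv _ _ t]
    by (simp add: parallel_transport_0)
qed

lemma parallel_transport_J:
  assumes t: "t \<in> {0..1}"
  shows "F t (J x) = J (F t x)"
proof -
  have "((\<lambda>t. J (F t x)) has_vector_derivative - D (c t) (J (F t x))) (at t within {0..1})" if "t \<in> {0..1}" for t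
    using bounded_linear.has_vector_derivative[OF linear_J[unfolded linear_conv_bounded_linear] parallel_transport_deriv[OF that, of x]]
    by (simp add: D_J)
  then show ?thesis
    using parallel_unique[of "\<lambda>t. F t (J x)" c "\<lambda>t. J (F t x)", OF parallel_transport_deriv _ _ t]
    by (simp add: parallel_transport_0)
qed

text \<open>By Jacobi's formula the determinant has logarithmic derivative
  \<open>- \<i> * connection_trace e (c t)\<close>, so its product with
  \<open>exp (\<i> * \<theta> t)\<close> is constant.\<close>

lemma det_parallel_transport:
  fixes e :: "'n::finite \<Rightarrow> 'a" and \<theta> :: "real \<Rightarrow> real"
  assumes e: "unitary_frame J g e"
    and \<theta>: "\<And>t. t \<in> {0..1} \<Longrightarrow> (\<theta> has_vector_derivative connection_trace e (c t)) (at t within {0..1})"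
  shows "det (frame_matrix J g e (F 1)) = exp (\<i> * complex_of_real (\<theta> 0 - \<theta> 1))"
proof -
  let ?U = "\<lambda>t. frame_matrix J g e (F t)"
  let ?E = "\<lambda>t. exp (\<i> * complex_of_real (\<theta> t))"
  have dU: "((\<lambda>t. det (?U t)) has_vector_derivative - (\<i> * connection_trace e (c t)) * det (?U t)) (at t within {0..1})"
    if t: "t \<in> {0..1}" for t
  proof -
    let ?N = "frame_matrix J g e (\<lambda>x. - D (c t) x)"
    have N: "linear (\<lambda>x. - D (c t) x)" by (intro linear_compose_neg linear_D)
    have mult: "?N ** ?U t = frame_matrix J g e (\<lambda>x. - D (c t) (F t x))"
      by (rule frame_matrix_compose[OF e N, symmetric]) (simp add: D_J)
    have "((\<lambda>t. ?U t $ i $ j) has_vector_derivative (?N ** ?U t) $ i $ j) (at t within {0..1})" for i j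
    proof -
      have "linear (\<lambda>y. Complex (g y (e i)) (g y (J (e i))))"
        by (rule linearI) (simp_all add: complex_eq_iff)
      then have "bounded_linear (\<lambda>y. Complex (g y (e i)) (g y (J (e i))))"
        by (simp add: linear_conv_bounded_linear)
      from bounded_linear.has_vector_derivative[OF this parallel_transport_deriv[OF t, of "e j"]]
      show ?thesis unfolding mult by (simp add: frame_matrix_def)
    qed
    from det_has_vector_derivative[OF this]
    have "((\<lambda>t. det (?U t)) has_vector_derivative trace ?N * det (?U t)) (at t within {0..1})" .
    moreover have "g (D (c t) (e i)) (e i) = 0" for i
      using D_skew[of "c t" "e i" "e i"] g_sym[of "D (c t) (e i)" "e i"] by linarith
    then have "trace ?N = - (\<i> * connection_trace e (c t))"
      by (simp add: trace_def frame_matrix_def connection_trace_def complex_eq_iff sum_negf)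
    ultimately show ?thesis by simp
  qed
  have dE: "(?E has_vector_derivative ?E t * (\<i> * connection_trace e (c t))) (at t within {0..1})"
    if t: "t \<in> {0..1}" for t
  proof -
    have "((\<lambda>t. \<i> * complex_of_real (\<theta> t)) has_vector_derivative \<i> * connection_trace e (c t)) (at t within {0..1})"
      by (intro has_vector_derivative_mult_right has_vector_derivative_of_real
          \<theta>[OF t, folded has_real_derivative_iff_has_vector_derivative])
    from field_vector_diff_chain_within[OF this, of exp "?E t"]
    show ?thesis by (simp add: o_def mult.commute has_field_derivative_at_within DERIV_exp)
  qed
  have "((\<lambda>t. det (?U t) * ?E t) has_vector_derivative 0) (at t within {0..1})" if "t \<in> {0..1}" for t
    using has_vector_derivative_mult[OF dU[OF that] dE[OF that]] by (simp add: algebra_simps)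
  then obtain k where k: "\<And>t. t \<in> {0..1} \<Longrightarrow> det (?U t) * ?E t = k"
    using has_vector_derivative_zero_constant[of "{0..1}" "\<lambda>t. det (?U t) * ?E t"] by auto
  have "?U 0 = mat 1"
    using frame_matrix_id[OF e] by (simp add: parallel_transport_0 frame_matrix_def)
  then have "det (?U 1) * ?E 1 = ?E 0" using k[of 0] k[of 1] by simp
  then have "det (?U 1) = ?E 0 / ?E 1" by (simp add: eq_divide_eq)
  then show ?thesis by (simp add: exp_diff[symmetric] right_diff_distrib)
qed

text \<open>The transport is unitary, as it preserves \<open>g\<close> and commutes with
  \<open>J\<close>; only the determinant remains to be examined.\<close>

lemma parallel_transport_special_unitary_iff:
  fixes e :: "'n::finite \<Rightarrow> 'a" and \<theta> :: "real \<Rightarrow> real"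
  assumes e: "unitary_frame J g e"
    and \<theta>: "\<And>t. t \<in> {0..1} \<Longrightarrow> (\<theta> has_vector_derivative connection_trace e (c t)) (at t within {0..1})"
  shows "F 1 \<in> special_unitary J g e \<longleftrightarrow> exp (\<i> * complex_of_real (\<theta> 0 - \<theta> 1)) = 1"
proof -
  have "frame_matrix J g e (F 1) ** map_matrix cnj (transpose (frame_matrix J g e (F 1))) = mat 1"
    by (rule frame_matrix_unitary[OF e]) (simp_all add: parallel_transport_J parallel_transport_g del: g_J_left)
  moreover have "linear (F 1)" by (rule parallel_transport_linear) simp
  moreover have "\<forall>x. F 1 (J x) = J (F 1 x)" by (simp add: parallel_transport_J)
  moreover have "det (frame_matrix J g e (F 1)) = exp (\<i> * complex_of_real (\<theta> 0 - \<theta> 1))"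
    by (rule det_parallel_transport[OF e \<theta>])
  ultimately show ?thesis
    unfolding special_unitary_def SU_def by simp
qed

end

lemma parallel_transport_exists:
  assumes "continuous_on {0..1} c"
  obtains F where "parallel_transport D c F"
proof -
  have "bilinear (\<lambda>x y. - D x y)"
    unfolding bilinear_def by (intro conjI allI linear_compose_neg linear_D linear_D_left)
  then have nD: "bounded_bilinear (\<lambda>x y. - D x y)"
    by (simp add: bilinear_conv_bounded_bilinear)
  have "\<exists>Y. Y 0 = y \<and> (\<forall>t\<in>{0..1}. (Y has_vector_derivative - D (c t) (Y t)) (at t within {0..1}))" for y
    by (rule linear_ode_exists[OF nD assms, of y]) (intro exI conjI ballI)
  then obtain Y where "\<And>y. Y y 0 = y \<and> (\<forall>t\<in>{0..1}. (Y y has_vector_derivative - D (c t) (Y y t)) (at t within {0..1}))"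
    by metis
  then have "parallel_transport D c (\<lambda>t y. Y y t)" unfolding parallel_transport_def by blast
  then show ?thesis by (rule that)
qed

text \<open>Along a contraction the \<open>s\<close>-derivative of the integral of
  \<open>\<tau> (u s t)\<close> is the integral of \<open>\<tau> (u' s t)\<close>. By the
  Maurer-Cartan equation this equals the integral of \<open>\<tau> (v' s t)\<close>, which is
  \<open>\<tau> (v s 1) - \<tau> (v s 0) = 0\<close>. At \<open>s = 0\<close> the integral
  vanishes.\<close>

lemma integral_null_homotopic:
  assumes "linear \<tau>" and \<tau>: "\<And>X Y. \<tau> (br X Y) = (0::real)" and "null_homotopic_loop br c"
  shows "continuous_on {0..1} c" and "integral {0..1} (\<lambda>t. \<tau> (c t)) = 0"
proof -
  obtain u v u' v' where cont: "\<forall>h\<in>{u, v, u', v'}. continuous_on ({0..1} \<times> {0..1}) (\<lambda>(s, t). h s t)"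
    and uv: "\<forall>s\<in>{0..1}. \<forall>t\<in>{0..1}.
        ((\<lambda>s. u s t) has_vector_derivative u' s t) (at s within {0..1}) \<and>
        ((\<lambda>t. v s t) has_vector_derivative v' s t) (at t within {0..1}) \<and>
        u' s t - v' s t = br (u s t) (v s t)"
    and u: "\<forall>t\<in>{0..1}. u 0 t = 0 \<and> u 1 t = c t" and v: "\<forall>s\<in>{0..1}. v s 0 = 0 \<and> v s 1 = 0"
    using assms(3) unfolding null_homotopic_loop_def by blast
  have bl: "bounded_linear \<tau>" using assms(1) by (simp add: linear_conv_bounded_linear)
  have cont2: "continuous_on {0..1} (\<lambda>t. u s t)" if "s \<in> {0..1}" for s
  proof -
    have "continuous_on {0..1} (\<lambda>t. (\<lambda>(s, t). u s t) (s, t))"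
      by (rule continuous_on_compose2[of "{0..1} \<times> {0..1}"]) (use cont that in \<open>auto intro!: continuous_intros\<close>)
    then show ?thesis by simp
  qed
  show c: "continuous_on {0..1} c"
    using cont2[of 1] u continuous_on_cong[of "{0..1}" "{0..1}" "u 1" c] by simp
  have "((\<lambda>s. integral (cbox 0 1) (\<lambda>t. \<tau> (u s t))) has_vector_derivative 0) (at s within {0..1})"
    if s: "s \<in> {0..1}" for s
  proof -
    have "((\<lambda>s. integral (cbox 0 1) (\<lambda>t. \<tau> (u s t))) has_vector_derivative
       integral (cbox 0 1) (\<lambda>t. \<tau> (u' s t))) (at s within {0..1})"
    proof (rule leibniz_rule_vector_derivative[OF _ _ _ s])
      show "((\<lambda>s. \<tau> (u s t)) has_vector_derivative \<tau> (u' s t)) (at s within {0..1})"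
        if "s \<in> {0..1}" "t \<in> cbox 0 1" for s t
        using uv that by (intro bounded_linear.has_vector_derivative[OF bl]) auto
      show "(\<lambda>t. \<tau> (u s t)) integrable_on cbox 0 1" if "s \<in> {0..1}" for s
        using cont2[OF that]
        by (intro integrable_continuous) (auto intro: bounded_linear.continuous_on[OF bl])
      have "continuous_on ({0..1} \<times> {0..1}) (\<lambda>p. \<tau> ((\<lambda>(s, t). u' s t) p))"
        using cont by (intro bounded_linear.continuous_on[OF bl]) auto
      then show "continuous_on ({0..1} \<times> cbox 0 1) (\<lambda>(s, t). \<tau> (u' s t))"
        by (simp add: split_beta)
    qed simp
    moreover have "integral (cbox 0 1) (\<lambda>t. \<tau> (u' s t)) = 0"
    proof -
      have "((\<lambda>t. \<tau> (v' s t)) has_integral \<tau> (v s 1) - \<tau> (v s 0)) {0..1}"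
        using uv s by (intro fundamental_theorem_of_calculus bounded_linear.has_vector_derivative[OF bl]) auto
      moreover have "\<tau> (v s 1) - \<tau> (v s 0) = 0" using v s linear_0[OF assms(1)] by simp
      moreover have *: "\<tau> (u' s t) = \<tau> (v' s t)" if "t \<in> {0..1}" for t
        using uv s that \<tau>[of "u s t" "v s t"] linear_diff[OF assms(1), of "u' s t" "v' s t"] by simp
      moreover have "integral (cbox 0 1) (\<lambda>t. \<tau> (u' s t)) = integral {0..1} (\<lambda>t. \<tau> (v' s t))"
        unfolding cbox_interval by (rule integral_cong) (rule *)
      ultimately show ?thesis by (simp add: integral_unique)
    qed
    ultimately show ?thesis by simp
  qed
  then obtain k where k: "\<And>s. s \<in> {0..1} \<Longrightarrow> integral (cbox 0 1) (\<lambda>t. \<tau> (u s t)) = k"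
    using has_vector_derivative_zero_constant[of "{0..1}" "\<lambda>s. integral (cbox 0 1) (\<lambda>t. \<tau> (u s t))"] by auto
  have "integral {0..1} (\<lambda>t. \<tau> (c t)) = integral {0..1} (\<lambda>t. \<tau> (u 1 t))"
    using u by (intro integral_cong) simp
  also have "\<dots> = integral {0..1} (\<lambda>t. \<tau> (u 0 t))" using k[of 0] k[of 1] by simp
  also have "\<dots> = integral {0..1} (\<lambda>t::real. 0)"
    using u linear_0[OF assms(1)] by (intro integral_cong) simp
  finally show "integral {0..1} (\<lambda>t. \<tau> (c t)) = 0" by simp
qed

lemma restricted_holonomy_subset:
  fixes e :: "'n::finite \<Rightarrow> 'a"
  assumes e: "unitary_frame J g e" and "\<And>X Y. connection_trace e (br X Y) = 0"
  shows "restricted_holonomy br D \<subseteq> special_unitary J g e"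
proof
  fix P assume "P \<in> restricted_holonomy br D"
  then obtain c F where P: "P = F 1" and c: "null_homotopic_loop br c" and F: "parallel_transport D c F"
    unfolding restricted_holonomy_def by blast
  let ?\<theta> = "\<lambda>t. integral {0..t} (\<lambda>t. connection_trace e (c t))"
  note I = integral_null_homotopic[OF linear_connection_trace[of e] assms(2) c]
  have "continuous_on {0..1} (\<lambda>t. connection_trace e (c t))"
    using linear_connection_trace[of e] I(1)
    by (simp add: linear_conv_bounded_linear bounded_linear.continuous_on)
  then have "(?\<theta> has_vector_derivative connection_trace e (c t)) (at t within {0..1})" if "t \<in> {0..1}" for t
    by (rule integral_has_vector_derivative[OF _ that])
  then show "P \<in> special_unitary J g e"
    using parallel_transport_special_unitary_iff[OF F e, of ?\<theta>] I(2) P by simp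
qed

end

section \<open>The Bismut connection on almost abelian Lie algebras\<close>

locale hermitian_lie_algebra =
  fixes br :: "'a::euclidean_space \<Rightarrow> 'a \<Rightarrow> 'a" and J :: "'a \<Rightarrow> 'a" and g :: "'a \<Rightarrow> 'a \<Rightarrow> real"
  assumes lie_bracket: "lie_bracket br" and hermitian: "hermitian_structure br J g"

sublocale hermitian_lie_algebra \<subseteq> hermitian_space J g
  using hermitian
  by (intro hermitian_space.intro) (simp_all add: hermitian_structure_def integrable_complex_structure_def)

context hermitian_lie_algebra
begin

lemma bilinear_br: "bilinear br"
  using lie_bracket by (simp add: lie_bracket_def)

lemma linear_br_left: "linear (\<lambda>x. br x y)" and linear_br: "linear (br x)"
  using bilinear_br by (auto simp: bilinear_def)

lemmas br_simps [simp] =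
  linear_add[OF linear_br_left] linear_add[OF linear_br]
  linear_diff[OF linear_br_left] linear_diff[OF linear_br]
  linear_neg[OF linear_br_left] linear_neg[OF linear_br]
  linear_0[OF linear_br_left] linear_0[OF linear_br]
  linear_cmul[OF linear_br_left] linear_cmul[OF linear_br]
  linear_sum[OF linear_br_left] linear_sum[OF linear_br]

lemma br_self [simp]: "br x x = 0"
  using lie_bracket by (simp add: lie_bracket_def)

lemma br_antisym: "br x y = - br y x"
proof -
  have "br (x + y) (x + y) = (br x x + br y y) + (br x y + br y x)"
    by (simp only: br_simps ac_simps)
  then have "br x y + br y x = 0" by (simp only: br_self add_0_left)
  then show ?thesis by (simp add: eq_neg_iff_add_eq_0)
qed

lemma integrable: "br (J x) (J y) = J (br (J x) y) + J (br x (J y)) + br x y"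
proof -
  have "br (J x) (J y) - J (br (J x) y) - J (br x (J y)) - br x y = 0"
    using hermitian by (simp add: hermitian_structure_def integrable_complex_structure_def)
  then show ?thesis by (simp add: algebra_simps)
qed

text \<open>The Koszul formula without its derivative terms, which vanish for left-invariant
  fields.\<close>

definition koszul :: "'a \<Rightarrow> 'a \<Rightarrow> 'a \<Rightarrow> real" where
  "koszul X Y Z = (g (br X Y) Z - g (br Y Z) X + g (br Z X) Y) / 2"

text \<open>Uniqueness holds because metric compatibility and vanishing torsion force the Koszul
  formula; existence because the vectors \<open>D0 X Y\<close> obtained from it by
  \<open>riesz\<close> form such a connection.\<close>

lemma levi_civita: "g (levi_civita br g X Y) Z = koszul X Y Z"
proof -
  let ?P = "\<lambda>D. bilinear D \<and> (\<forall>X Y Z. g (D X Y) Z + g Y (D X Z) = 0) \<and> (\<forall>X Y. D X Y - D Y X = br X Y)"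
  have koszul_if: "g (D X Y) Z = koszul X Y Z" if D: "?P D" for D X Y Z
  proof -
    have skew: "g (D X Y) Z = - g (D X Z) Y" for X Y Z
    proof -
      have "g (D X Y) Z + g Y (D X Z) = 0" using D by blast
      then show ?thesis using g_sym[of Y "D X Z"] by linarith
    qed
    have tor: "g (br X Y) Z = g (D X Y) Z - g (D Y X) Z" for X Y Z
    proof -
      have "br X Y = D X Y - D Y X" using D by simp
      then show ?thesis by (simp only: g_simps)
    qed
    show ?thesis
      unfolding koszul_def tor using skew[of X Z Y] skew[of Y Z X] skew[of Z X Y] by simp
  qed
  define D0 where "D0 = (\<lambda>X Y. THE W. \<forall>Z. g W Z = koszul X Y Z)"
  have D0: "g (D0 X Y) Z = koszul X Y Z" for X Y Z
  proof -
    have "linear (koszul X Y)"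
      by (rule linearI) (simp_all add: koszul_def algebra_simps add_divide_distrib diff_divide_distrib)
    from theI'[OF riesz[OF this]] show ?thesis unfolding D0_def by blast
  qed
  have "?P D0"
  proof (intro conjI allI)
    show "bilinear D0"
      unfolding bilinear_def
      by (intro conjI allI linearI eq_if_g_eq)
        (simp_all add: D0 koszul_def algebra_simps add_divide_distrib diff_divide_distrib)
    show "g (D0 X Y) Z + g Y (D0 X Z) = 0" for X Y Z
      unfolding g_sym[of Y "D0 X Z"] D0 koszul_def
      using arg_cong[OF br_antisym[of Z X], of "\<lambda>x. g x Y"] arg_cong[OF br_antisym[of Y X], of "\<lambda>x. g x Z"]
        arg_cong[OF br_antisym[of Z Y], of "\<lambda>x. g x X"]
      by (simp add: field_simps)
    show "D0 X Y - D0 Y X = br X Y" for X Y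
    proof (rule eq_if_g_eq)
      fix Z
      show "g (D0 X Y - D0 Y X) Z = g (br X Y) Z"
        using arg_cong[OF br_antisym[of Z X], of "\<lambda>x. g x Y"] arg_cong[OF br_antisym[of Y X], of "\<lambda>x. g x Z"]
          arg_cong[OF br_antisym[of Z Y], of "\<lambda>x. g x X"]
        by (simp add: D0 koszul_def field_simps)
    qed
  qed
  moreover have "D = D0" if "?P D" for D
    using koszul_if[OF that] D0 by (intro ext eq_if_g_eq) simp
  ultimately have "levi_civita br g = D0"
    unfolding levi_civita_def by (rule the_equality)
  then show ?thesis by (simp add: D0)
qed

lemma ce_differential_fundamental_form:
  "ce_differential br (fundamental_form J g) [X, Y, Z] = g (br X Y) (J Z) - g (br X Z) (J Y) + g (br Y Z) (J X)"
  by (simp add: ce_differential_def fundamental_form_def nths_Cons eval_nat_numeral)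

text \<open>The right-hand side is linear in \<open>Z\<close>, so \<open>riesz\<close> provides the
  vector in the definition; \<open>J (J Z) = - Z\<close> simplifies the torsion term.\<close>

lemma bismut:
  "g (bismut br J g X Y) Z =
     koszul X Y Z + (- g (br (J X) (J Y)) Z + g (br (J X) (J Z)) Y - g (br (J Y) (J Z)) X) / 2" (is "_ = ?b Z")
proof -
  have "linear ?b"
    by (rule linearI) (simp_all add: koszul_def algebra_simps add_divide_distrib diff_divide_distrib)
  have *: "(\<forall>Z. g W Z = g (levi_civita br g X Y) Z + 1 / 2 * ce_differential br (fundamental_form J g) [J X, J Y, J Z])
      \<longleftrightarrow> (\<forall>Z. g W Z = ?b Z)" for W
    by (simp add: levi_civita ce_differential_fundamental_form)
  have "\<forall>Z. g (bismut br J g X Y) Z = ?b Z"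
    unfolding bismut_def * by (rule theI'[OF riesz]) fact
  then show ?thesis by blast
qed

end

text \<open>The torsion term is alternating, so the connection remains metric. That \<open>J\<close>
  is parallel follows from integrability for the pairs \<open>(X, Y)\<close> and
  \<open>(X, Z)\<close>.\<close>

sublocale hermitian_lie_algebra \<subseteq> hermitian_connection J g "bismut br J g"
proof
  have as: "g (br x y) z = - g (br y x) z" for x y z
    using arg_cong[OF br_antisym[of x y], of "\<lambda>x. g x z"] by simp
  show "bilinear (bismut br J g)"
    unfolding bilinear_def
    by (intro conjI allI linearI eq_if_g_eq)
      (simp_all add: bismut koszul_def algebra_simps add_divide_distrib diff_divide_distrib)
  show "g (bismut br J g X Y) Z = - g Y (bismut br J g X Z)" for X Y Z
    unfolding g_sym[of Y "bismut br J g X Z"] bismut koszul_def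
    using as[of Z X Y] as[of Y X Z] as[of Z Y X] as[of "J Z" "J Y" X] by (simp add: field_simps)
  show "bismut br J g X (J Y) = J (bismut br J g X Y)" for X Y
  proof (rule eq_if_g_eq)
    fix Z
    have int: "g (br (J X) (J A)) (J B) = g (br (J X) A) B + g (br X (J A)) B + g (br X A) (J B)" for A B
      unfolding integrable[of X A] by simp
    show "g (bismut br J g X (J Y)) Z = g (J (bismut br J g X Y)) Z"
      unfolding g_J_left bismut koszul_def
      using int[of Y Z] int[of Z Y] as[of Z X "J Y"] as[of "J Z" X Y]
      by (simp add: field_simps)
  qed
qed

context hermitian_lie_algebra
begin

text \<open>The terms of \<open>g (bismut br J g X Y) (J Y)\<close> group into those of the traces
  of \<open>J ad_X\<close> and \<open>ad_(J X)\<close> and the term with \<open>br Y (J Y)\<close>.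
  The trace of \<open>ad_(J X)\<close> vanishes by unimodularity.\<close>

lemma connection_trace_bismut:
  fixes e :: "'n::finite \<Rightarrow> 'a"
  assumes e: "unitary_frame J g e" and "unimodular br"
  shows "connection_trace e X =
     - endo_trace (\<lambda>Y. J (br X Y)) / 2 - g (\<Sum>i\<in>UNIV. br (e i) (J (e i))) X"
proof -
  have as: "g (br x y) z = - g (br y x) z" for x y z
    using arg_cong[OF br_antisym[of x y], of "\<lambda>x. g x z"] by simp
  have "g (bismut br J g X Y) (J Y) = - (g (J (br X Y)) Y + g (J (br X (J Y))) (J Y)) / 2
      - g (br Y (J Y)) X - (g (br (J X) Y) Y + g (br (J X) (J Y)) (J Y)) / 2" for Y
    unfolding bismut koszul_def using as[of "J Y" X Y] as[of "J Y" Y X] by (simp add: field_simps)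
  moreover have "endo_trace (br (J X)) = 0" using assms(2) by (simp add: unimodular_def)
  ultimately show ?thesis
    using endo_trace_unitary_frame[OF e linear_br[of "J X"]]
      endo_trace_unitary_frame[OF e linear_compose[OF linear_br[of X] linear_J], unfolded o_def]
    by (simp add: connection_trace_def sum_subtractf sum.distrib sum_negf sum_divide_distrib[symmetric]
        del: g_J_left)
qed

end

text \<open>The abelian ideal is encoded as the orthogonal complement of \<xi>: by
  \<open>br_eq\<close> brackets within it vanish, and by \<open>br_orth\<close> it contains all
  brackets.\<close>

locale almost_abelian_hermitian = hermitian_lie_algebra +
  fixes \<xi> :: 'a
  assumes unimodular: "unimodular br" and \<xi>_unit: "g \<xi> \<xi> = 1"
    and br_eq: "br x y = g x \<xi> *\<^sub>R br \<xi> y - g y \<xi> *\<^sub>R br \<xi> x"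
    and br_orth: "g (br x y) \<xi> = 0"
begin

abbreviation \<eta> :: 'a where "\<eta> \<equiv> J \<xi>"

text \<open>For \<open>y\<close> orthogonal to \<xi> and \<eta>, both \<open>y\<close> and
  \<open>J y\<close> lie in the ideal and commute with \<eta>. Integrability then reads
  \<open>br \<xi> y = - J (br \<xi> (J y))\<close>, whose product with \<eta> is, up to sign, that
  of a bracket with \<xi>.\<close>

lemma g_br_\<eta>:
  assumes "g x \<xi> = 0"
  shows "g (br \<xi> x) \<eta> = g x \<eta> * g (br \<xi> \<eta>) \<eta>"
proof -
  define y where "y = x - g x \<eta> *\<^sub>R \<eta>"
  have "g \<eta> \<eta> = 1" "g \<eta> \<xi> = 0" using \<xi>_unit by simp_all
  then have y: "g y \<xi> = 0" "g y \<eta> = 0" using assms by (simp_all add: y_def del: g_J_left)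
  then have "g (J y) \<xi> = 0" by simp
  then have "br \<eta> y = 0" "br \<eta> (J y) = 0"
    using br_eq[of \<eta> y] br_eq[of \<eta> "J y"] y \<open>g \<eta> \<xi> = 0\<close> by (simp_all del: g_J_left)
  then have "br \<xi> y = - J (br \<xi> (J y))" using integrable[of \<xi> y] by (simp add: eq_neg_iff_add_eq_0 add.commute)
  then have "g (br \<xi> y) \<eta> = 0" using br_orth[of \<xi> "J y"] by simp
  then show ?thesis by (simp add: y_def del: g_J_left)
qed

text \<open>By \<open>br_eq\<close> each bracket is \<open>br \<xi>\<close> of the part of \<eta>
  along \<open>e i\<close> and \<open>J (e i)\<close>; these parts add up to \<eta>.\<close>

lemma sum_br_frame:
  fixes e :: "'n::finite \<Rightarrow> 'a"
  assumes e: "unitary_frame J g e"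
  shows "(\<Sum>i\<in>UNIV. br (e i) (J (e i))) = br \<xi> \<eta>"
proof -
  have "br (e i) (J (e i)) = br \<xi> (g \<eta> (e i) *\<^sub>R e i + g \<eta> (J (e i)) *\<^sub>R J (e i))" for i
    unfolding br_eq[of "e i"] using g_sym[of \<xi> "e i"] g_sym[of \<xi> "J (e i)"] by simp
  then have "(\<Sum>i\<in>UNIV. br (e i) (J (e i))) = br \<xi> (\<Sum>i\<in>UNIV. g \<eta> (e i) *\<^sub>R e i + g \<eta> (J (e i)) *\<^sub>R J (e i))"
    by (simp only: linear_sum[OF linear_br])
  then show ?thesis using unitary_frame_expansion[OF e, of \<eta>] by simp
qed

lemma endo_trace_rank_1: "endo_trace (\<lambda>x. g x a *\<^sub>R b) = g b a"
proof -
  have "endo_trace (\<lambda>x. g x a *\<^sub>R b) = g (\<Sum>i\<in>Basis. (b \<bullet> i) *\<^sub>R i) a"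
    unfolding endo_trace_def linear_sum[OF linear_g_left] by (simp add: mult.commute)
  then show ?thesis by (simp add: euclidean_representation)
qed

text \<open>For \<open>x\<close> in the ideal, \<open>br x\<close> maps \<open>y\<close> to
  \<open>- g y \<xi>\<close> times \<open>br \<xi> x\<close>. It has rank at most one, so the trace
  of \<open>J ad_x\<close> is a single product, given by \<open>g_br_\<eta>\<close>.\<close>

lemma connection_trace_orth:
  fixes e :: "'n::finite \<Rightarrow> 'a"
  assumes e: "unitary_frame J g e" and x: "g x \<xi> = 0"
  shows "connection_trace e x = - g x \<eta> * g (br \<xi> \<eta>) \<eta> / 2 - g (br \<xi> \<eta>) x"
proof -
  have "(\<lambda>y. J (br x y)) = (\<lambda>y. g y \<xi> *\<^sub>R - J (br \<xi> x))"
    using x by (subst br_eq) simp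
  then have "endo_trace (\<lambda>y. J (br x y)) = g (br \<xi> x) \<eta>"
    using endo_trace_rank_1[of \<xi> "- J (br \<xi> x)"] by simp
  then show ?thesis
    unfolding connection_trace_bismut[OF e unimodular] sum_br_frame[OF e] g_br_\<eta>[OF x] by simp
qed

lemma connection_trace_br_eq_0:
  fixes e :: "'n::finite \<Rightarrow> 'a"
  assumes "unitary_frame J g e" and "br \<xi> \<eta> = 0"
  shows "connection_trace e (br x y) = 0"
  using connection_trace_orth[OF assms(1) br_orth, of x y] assms(2) by simp

lemma connection_trace_br_neq_0:
  fixes e :: "'n::finite \<Rightarrow> 'a"
  assumes "unitary_frame J g e" and "br \<xi> \<eta> \<noteq> 0"
  shows "connection_trace e (br \<xi> \<eta>) < 0"
proof -
  have "g (br \<xi> \<eta>) (br \<xi> \<eta>) > 0" using assms(2) inner_product_g by (auto simp: inner_product_def)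
  moreover have "g (br \<xi> \<eta>) \<eta> * g (br \<xi> \<eta>) \<eta> \<ge> 0" by simp
  ultimately show ?thesis using connection_trace_orth[OF assms(1) br_orth, of \<xi> \<eta>] by linarith
qed

end

text \<open>
  The loop is contracted through scaling \<open>p\<close> and \<open>q\<close> by \<open>s\<close>. With \<open>B = br X\<close>, the functions \<open>u\<close> and
  \<open>v\<close> below are the components of \<open>f\<^sup>-\<^sup>1 df\<close> for \<open>f = (x, exp (x B) (k Y))\<close> in the semidirect product
  \<open>\<real> \<ltimes> H\<close>, where \<open>x = s p(t)\<close> and \<open>k = s q(t)\<close>; the exponentials cancel.
\<close>

lemma null_homotopic_loop_scaling:
  fixes br :: "'a::euclidean_space \<Rightarrow> 'a \<Rightarrow> 'a" and p q p' q' :: "real \<Rightarrow> real"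
  assumes "lie_bracket br" and YZ: "br Y (br X Y) = 0"
    and dp: "\<And>t. (p has_real_derivative p' t) (at t)" and dq: "\<And>t. (q has_real_derivative q' t) (at t)"
    and cont: "continuous_on UNIV p'" "continuous_on UNIV q'"
    and 0: "p 0 = 0" "p 1 = 0" "q 0 = 0" "q 1 = 0"
  shows "null_homotopic_loop br (\<lambda>t. p' t *\<^sub>R X + (p' t * q t) *\<^sub>R br X Y + q' t *\<^sub>R Y)"
proof -
  let ?Z = "br X Y"
  have bil: "bilinear br" and self: "br V V = 0" for V
    using assms(1) by (auto simp: lie_bracket_def)
  have anti: "br V W = - br W V" for V W
  proof -
    have "br (V + W) (V + W) = (br V V + br W W) + (br V W + br W V)"
      by (simp only: bilinear_ladd[OF bil] bilinear_radd[OF bil] ac_simps)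
    then have "br V W + br W V = 0" by (simp only: self add_0_left)
    then show ?thesis by (simp add: eq_neg_iff_add_eq_0)
  qed
  have cq: "continuous_on UNIV q"
    by (rule DERIV_continuous_on) (rule dq)
  have cp: "continuous_on UNIV p"
    by (rule DERIV_continuous_on) (rule dp)
  have ct: "continuous_on S (\<lambda>z. f (snd z))" if "continuous_on UNIV f" for f :: "real \<Rightarrow> real" and S :: "(real \<times> real) set"
    using continuous_on_compose2[OF that continuous_on_snd[OF continuous_on_id]] by simp
  note [continuous_intros] = ct[OF cq] ct[OF cp] ct[OF cont(1)] ct[OF cont(2)]
  define u where "u = (\<lambda>s t. (s * p' t) *\<^sub>R X + (s\<^sup>2 * p' t * q t) *\<^sub>R ?Z + (s * q' t) *\<^sub>R Y)"
  define v where "v = (\<lambda>s t. p t *\<^sub>R X + (s * p t * q t) *\<^sub>R ?Z + q t *\<^sub>R Y)"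
  define u' where "u' = (\<lambda>s t. p' t *\<^sub>R X + (s * p' t * q t + s * p' t * q t) *\<^sub>R ?Z + q' t *\<^sub>R Y)"
  define v' where "v' = (\<lambda>s t. p' t *\<^sub>R X + (s * (p' t * q t + p t * q' t)) *\<^sub>R ?Z + q' t *\<^sub>R Y)"
  show ?thesis
    unfolding null_homotopic_loop_def
  proof (intro exI conjI ballI)
    fix h assume "h \<in> {u, v, u', v'}"
    then show "continuous_on ({0..1} \<times> {0..1}) (\<lambda>(s, t). h s t)"
      by (auto simp: u_def v_def u'_def v'_def split_beta intro!: continuous_intros)
  next
    fix s t :: real
    have dpt: "(p has_real_derivative p' t) (at t within {0..1})" "(q has_real_derivative q' t) (at t within {0..1})"
      using dp dq by (auto intro: has_field_derivative_at_within)
    have sc: "((\<lambda>x. a x *\<^sub>R W) has_vector_derivative d *\<^sub>R W) (at x within S)"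
      if "(a has_real_derivative d) (at x within S)" for a d x S and W :: 'a
      using has_vector_derivative_scaleR[OF that has_vector_derivative_const[of W]] by simp
    show "((\<lambda>s. u s t) has_vector_derivative u' s t) (at s within {0..1})"
      unfolding u_def u'_def
      by (intro has_vector_derivative_add sc) (rule derivative_eq_intros refl | simp add: algebra_simps)+
    show "((\<lambda>t. v s t) has_vector_derivative v' s t) (at t within {0..1})"
      unfolding v_def v'_def
      by (intro has_vector_derivative_add sc) (rule derivative_eq_intros dpt refl | simp add: algebra_simps)+
    have double: "(a * (b * (c * 2))) *\<^sub>R W = (a * (b * c)) *\<^sub>R W + (a * (b * c)) *\<^sub>R W"
      for a b c and W :: 'a by (simp flip: scaleR_left_distrib)
    \<comment> \<open>Both sides are \<open>s * (p' t * q t - p t * q' t)\<close> times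
      \<open>?Z\<close>: the terms with \<open>br X ?Z\<close> cancel, and
      \<open>br Y ?Z = 0\<close>.\<close>
    show "u' s t - v' s t = br (u s t) (v s t)"
      unfolding u_def v_def u'_def v'_def
      using YZ anti[of ?Z X] anti[of ?Z Y] anti[of Y X]
      by (simp add: bilinear_ladd[OF bil] bilinear_radd[OF bil] bilinear_lmul[OF bil] bilinear_rmul[OF bil] self)
        (simp add: algebra_simps power2_eq_square double)
  next
    fix t :: real
    show "u 0 t = 0" "u 1 t = p' t *\<^sub>R X + (p' t * q t) *\<^sub>R br X Y + q' t *\<^sub>R Y"
      by (simp_all add: u_def)
    show "v t 0 = 0" "v t 1 = 0" by (simp_all add: v_def 0)
  qed
qed

section \<open>The balanced condition\<close>

context hermitian_space
begin

lemma alternating_form_fundamental_form: "alternating_form 2 (fundamental_form J g)"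
  unfolding alternating_form_def
proof (intro conjI allI impI)
  fix ys :: "'a list" assume "Suc (length ys) = 2"
  then obtain y where "ys = [y]" by (auto simp: length_Suc_conv numeral_2_eq_2)
  then show "linear (\<lambda>x. fundamental_form J g (x # ys))"
    by (intro linearI) (simp_all add: fundamental_form_def)
next
  fix x y and as bs :: "'a list" assume "length as + length bs + 2 = 2"
  then show "fundamental_form J g (as @ x # y # bs) = - fundamental_form J g (as @ y # x # bs)"
    using g_sym[of x "J y"] by (simp add: fundamental_form_def)
qed

text \<open>The interleaved order lets \<open>two_form_power_split\<close> remove one complex line
  at a time.\<close>

definition J_list :: "'a list \<Rightarrow> 'a list" where
  "J_list fs = concat (map (\<lambda>f. [f, J f]) fs)"

lemma J_list_simps [simp]: "J_list [] = []" "J_list (f # fs) = f # J f # J_list fs"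
  by (simp_all add: J_list_def)

lemma length_J_list [simp]: "length (J_list fs) = 2 * length fs"
  by (induction fs) auto

lemma set_J_list: "set (J_list fs) = set fs \<union> J ` set fs"
  by (induction fs) auto

text \<open>Wirtinger's identity: on a complex space of dimension \<open>m\<close> the
  \<open>m\<close>-th power of the fundamental form is \<open>fact m\<close> times the volume
  form.\<close>

lemma two_form_power_J_list:
  assumes "unitary_set (set fs)" and "distinct fs"
  shows "two_form_power (fundamental_form J g) (length fs) (J_list fs) = fact (length fs)"
  using assms
proof (induction fs)
  case (Cons f fs)
  have u: "unitary_set (set fs)" using Cons.prems(1) by (simp add: unitary_set_def)
  have f: "g f f = 1" "g f (J h) = 0" "g f h = 0" if "h \<in> set fs" for h
    using unitary_setD(2,3)[OF Cons.prems(1), of f h] unitary_setD(2)[OF Cons.prems(1), of f f] Cons.prems(2) that by auto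
  have ff: "g f f = 1" using unitary_setD(2)[OF Cons.prems(1), of f f] by simp
  have "two_form_power (fundamental_form J g) (Suc (length fs)) (f # J f # J_list fs) =
      real (Suc (length fs)) * fundamental_form J g [f, J f] * two_form_power (fundamental_form J g) (length fs) (J_list fs)"
    by (rule two_form_power_split[OF alternating_form_fundamental_form])
      (use f in \<open>auto simp: set_J_list fundamental_form_def\<close>)
  moreover have "fundamental_form J g [f, J f] = 1" using ff by (simp add: fundamental_form_def)
  ultimately show ?case using Cons.IH[OF u] Cons.prems(2) by (simp del: two_form_power.simps)
qed simp

end

context almost_abelian_hermitian
begin

text \<open>On lists of distinct vectors of the basis \<xi>, \<eta>, \<open>us\<close> the form
  \<delta> has room for all but one of them. Omitting \<xi> gives 0; omitting \<eta> or some
  \<open>u\<close> in \<open>us\<close> gives, up to a nonzero factor, the component of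
  \<open>br \<xi> \<eta>\<close> along the omitted vector.\<close>

lemma balanced_iff:
  assumes n: "DIM('a) = 2 * n"
  shows "balanced n br J g \<longleftrightarrow> br \<xi> \<eta> = 0"
proof -
  have "unitary_set {\<xi>}" using \<xi>_unit by (simp add: unitary_set_def)
  then obtain F where F: "{\<xi>} \<subseteq> F" "unitary_set F" "span (F \<union> J ` F) = UNIV" "2 * card F = DIM('a)"
    using unitary_set_complete by metis
  obtain fs where fs: "set fs = F - {\<xi>}" "distinct fs"
    using finite_distinct_list unitary_setD(1)[OF F(2)] by (metis finite_Diff)
  have lfs: "Suc (length fs) = n"
    using distinct_card[OF fs(2)] fs(1) F(1,4) card.remove[OF unitary_setD(1)[OF F(2)], of \<xi>] n by simp
  define us where "us = J_list fs"
  define \<alpha> where "\<alpha> = two_form_power (fundamental_form J g) (n - 1)"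
  define \<delta> where "\<delta> = ce_differential br \<alpha>"
  let ?N = "2 * (n - 1)"
  have lus: "length us = ?N" using lfs by (auto simp: us_def)
  have sus: "set us = set fs \<union> J ` set fs" by (simp add: us_def set_J_list)
  have ufs: "unitary_set (set fs)" using F(2) fs(1) by (auto simp: unitary_set_def)
  have dus: "distinct us"
  proof -
    have "card (set us) = 2 * card (set fs)"
      unfolding sus using unitary_set_J_disjoint[OF ufs] by (simp add: card_Un_disjoint card_image)
    then show ?thesis using distinct_card[OF fs(2)] by (intro card_distinct) (simp add: us_def)
  qed
  have orth: "g u \<xi> = 0" "g u \<eta> = 0" if "u \<in> set us" for u
    using that unitary_setD(2,3)[OF F(2), of _ \<xi>] F(1) fs(1) by (auto simp: sus)
  have S: "F \<union> J ` F = insert \<xi> (insert \<eta> (set us))"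
    using F(1) fs(1) by (auto simp: sus)
  have \<alpha>: "alternating_form ?N \<alpha>"
    unfolding \<alpha>_def by (rule alternating_form_two_form_power[OF alternating_form_fundamental_form])
  have \<delta>: "alternating_form (Suc ?N) \<delta>"
    unfolding \<delta>_def by (rule alternating_form_ce_differential[OF bilinear_br br_antisym \<alpha>])
  have \<alpha>us: "\<alpha> us \<noteq> 0"
    using two_form_power_J_list[OF ufs fs(2)] lfs by (auto simp: \<alpha>_def us_def)
  have expand: "L w = g w \<eta> * L \<eta> + (\<Sum>u\<in>set us. g w u * L u)" if L: "linear L" and w: "g w \<xi> = 0" for L w
  proof -
    have d: "set fs \<inter> J ` set fs = {}" "inj_on J (set fs)" using unitary_set_J_disjoint[OF ufs] by auto
    have "w = (\<Sum>f\<in>F. g w f *\<^sub>R f + g w (J f) *\<^sub>R J f)" by (rule unitary_expansion[OF F(2,3)])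
    also have "\<dots> = g w \<eta> *\<^sub>R \<eta> + (\<Sum>f\<in>set fs. g w f *\<^sub>R f + g w (J f) *\<^sub>R J f)"
      using w F(1) fs(1) unitary_setD(1)[OF F(2)] by (simp add: sum.remove[of F \<xi>])
    also have "\<dots> = g w \<eta> *\<^sub>R \<eta> + (\<Sum>u\<in>set us. g w u *\<^sub>R u)"
      unfolding sus using d by (simp add: sum.union_disjoint sum.reindex sum.distrib)
    finally have "L w = L (g w \<eta> *\<^sub>R \<eta> + (\<Sum>u\<in>set us. g w u *\<^sub>R u))" by simp
    then show ?thesis by (simp add: linear_add[OF L] linear_sum[OF L] linear_cmul[OF L])
  qed
  \<comment> \<open>The fundamental form pairs \<eta> only with \<xi>, so \<eta> is in its kernel on
    the ideal.\<close>
  have kernel: "\<alpha> Ys = 0" if "length Ys = ?N" "\<eta> \<in> set Ys" "\<forall>y\<in>set Ys. g y \<xi> = 0" for Ys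
    unfolding \<alpha>_def
  proof (rule two_form_power_kernel[OF that(1,2)])
    fix y assume "y \<in> set Ys"
    then have "g y \<xi> = 0" using that(3) by blast
    then show "fundamental_form J g [\<eta>, y] = 0" "fundamental_form J g [y, \<eta>] = 0"
      using g_sym[of \<xi> y] by (simp_all add: fundamental_form_def)
  qed
  have ce_0: "ce_differential br \<beta> Ys = 0"
    if "\<And>as. Suc (Suc (length as)) = length Ys \<Longrightarrow> \<beta> (0 # as) = 0" "\<forall>y\<in>set Ys. g y \<xi> = 0" for \<beta> and Ys :: "'a list"
    unfolding ce_differential_def
  proof (intro sum.neutral ballI)
    fix j i assume "j \<in> {..<length Ys}" "i \<in> {..<j}"
    then have ij: "i < j" "j < length Ys" by auto
    have "br (Ys ! i) (Ys ! j) = 0"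
      using br_eq[of "Ys ! i" "Ys ! j"] that(2) ij by simp
    then show "(- 1) ^ (i + j) * \<beta> (br (Ys ! i) (Ys ! j) # nths Ys (- {i, j})) = 0"
      using that(1)[of "nths Ys (- {i, j})"] length_nths_remove2[OF ij] by simp
  qed
  \<comment> \<open>In Cartan's formula the differential of the contracted form vanishes, because
    all brackets within the ideal do.\<close>
  have \<delta>_\<xi>: "\<delta> (\<xi> # Ys) = - derivation (br \<xi>) \<alpha> Ys" if l: "length Ys = ?N" and o: "\<forall>y\<in>set Ys. g y \<xi> = 0" for Ys
  proof -
    have "ce_differential br (\<lambda>Zs. \<alpha> (\<xi> # Zs)) Ys = 0"
    proof (rule ce_0[OF _ o])
      fix as :: "'a list" assume "Suc (Suc (length as)) = length Ys"
      then have "linear (\<lambda>x. \<alpha> ([\<xi>] @ x # as))" using l by (intro alternating_form_linear[OF \<alpha>]) simp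
      from linear_0[OF this] show "\<alpha> (\<xi> # 0 # as) = 0" by simp
    qed
    then show ?thesis using ce_differential_Cons[of Ys \<alpha> br \<xi>] \<alpha> l by (simp add: \<delta>_def)
  qed
  \<comment> \<open>On \<open>us\<close> the form \<alpha> is a volume form, so the derivation
    multiplies it by the trace of \<open>br \<xi>\<close> over \<open>us\<close>. As the full trace
    is zero and \<xi> contributes nothing, this is
    \<open>- g (br \<xi> \<eta>) \<eta>\<close>.\<close>
  have \<delta>1: "\<delta> (\<xi> # us) = g (br \<xi> \<eta>) \<eta> * \<alpha> us"
  proof -
    \<comment> \<open>Only the component of \<open>w\<close> along \<open>us ! j\<close> counts:
      other vectors of \<open>us\<close> create a repetition, and \<eta> lies in the kernel.\<close>
    have upd: "\<alpha> (us[j := w]) = g w (us ! j) * \<alpha> us" if j: "j < length us" and w: "g w \<xi> = 0" for j w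
    proof -
      have "linear (\<lambda>x. \<alpha> (us[j := x]))" by (rule alternating_form_update[OF \<alpha> lus]) (use j lus in simp)
      from expand[OF this w]
      have "\<alpha> (us[j := w]) = g w \<eta> * \<alpha> (us[j := \<eta>]) + (\<Sum>u\<in>set us. g w u * \<alpha> (us[j := u]))" .
      also have "\<alpha> (us[j := \<eta>]) = 0"
      proof (rule kernel)
        show "\<eta> \<in> set (us[j := \<eta>])" using j by (rule set_update_memI)
        show "\<forall>y\<in>set (us[j := \<eta>]). g y \<xi> = 0"
          using set_update_subset_insert[of us j \<eta>] orth(1) by auto
      qed (simp add: lus)
      also have "(\<Sum>u\<in>set us. g w u * \<alpha> (us[j := u])) = (\<Sum>u\<in>set us. if u = us ! j then g w (us ! j) * \<alpha> us else 0)"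
      proof (intro sum.cong refl)
        fix u assume "u \<in> set us"
        then obtain k where k: "k < length us" "u = us ! k" by (metis in_set_conv_nth)
        show "g w u * \<alpha> (us[j := u]) = (if u = us ! j then g w (us ! j) * \<alpha> us else 0)"
        proof (cases "u = us ! j")
          case False
          then have "k \<noteq> j" using k by auto
          then have "us[j := u] ! j = us[j := u] ! k" using k j by simp
          then have "\<not> distinct (us[j := u])"
            using nth_eq_iff_index_eq[of "us[j := u]" j k] \<open>k \<noteq> j\<close> k(1) j by auto
          then show ?thesis using alternating_form_not_distinct[OF \<alpha>, of "us[j := u]"] lus False by simp
        qed (simp add: j)
      qed
      finally show ?thesis using j by simp
    qed
    have "derivation (br \<xi>) \<alpha> us = (\<Sum>j<length us. g (br \<xi> (us ! j)) (us ! j)) * \<alpha> us"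
      unfolding derivation_def sum_distrib_right by (intro sum.cong refl upd) (use br_orth in auto)
    also have "(\<Sum>j<length us. g (br \<xi> (us ! j)) (us ! j)) = (\<Sum>u\<in>set us. g (br \<xi> u) u)"
      using dus by (simp add: sum_list_sum_nth[symmetric] sum.distinct_set_conv_list lessThan_atLeast0 sum_list_sum_nth)
    also have "\<dots> = - g (br \<xi> \<eta>) \<eta>"
    proof -
      have d: "set fs \<inter> J ` set fs = {}" "inj_on J (set fs)" using unitary_set_J_disjoint[OF ufs] by auto
      have "0 = (\<Sum>f\<in>F. g (br \<xi> f) f + g (br \<xi> (J f)) (J f))"
        using endo_trace_unitary[OF F(2,3) linear_br[of \<xi>]] unimodular by (simp add: unimodular_def del: g_J_left)
      also have "\<dots> = g (br \<xi> \<eta>) \<eta> + (\<Sum>f\<in>set fs. g (br \<xi> f) f + g (br \<xi> (J f)) (J f))"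
        using F(1) fs(1) unitary_setD(1)[OF F(2)] by (simp add: sum.remove[of F \<xi>])
      also have "\<dots> = g (br \<xi> \<eta>) \<eta> + (\<Sum>u\<in>set us. g (br \<xi> u) u)"
        unfolding sus using d by (simp add: sum.union_disjoint sum.reindex sum.distrib)
      finally show ?thesis by simp
    qed
    finally show ?thesis using \<delta>_\<xi>[OF lus] orth(1) by simp
  qed
  \<comment> \<open>Only the term in which \<open>br \<xi>\<close> acts on \<eta> survives, since
    the others still contain \<eta>.\<close>
  have \<delta>2: "\<delta> (\<xi> # \<eta> # Zs) = - \<alpha> (br \<xi> \<eta> # Zs)" if l: "Suc (length Zs) = ?N" and o: "\<forall>z\<in>set Zs. g z \<xi> = 0" for Zs
  proof -
    have "\<alpha> (\<eta> # Zs[j := br \<xi> (Zs ! j)]) = 0" for j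
      using l o br_orth set_update_subset_insert[of Zs j "br \<xi> (Zs ! j)"] by (intro kernel) auto
    then have "derivation (br \<xi>) (\<lambda>zs. \<alpha> (\<eta> # zs)) Zs = 0" by (simp add: derivation_def)
    then show ?thesis using \<delta>_\<xi>[of "\<eta> # Zs"] l o by (simp add: derivation_Cons)
  qed
  have "balanced n br J g \<longleftrightarrow> (\<forall>Xs. length Xs = Suc ?N \<longrightarrow> \<delta> Xs = 0)"
  proof -
    \<comment> \<open>The truncated subtractions agree because \<open>n\<close> is positive.\<close>
    have "2 * n - 1 = Suc ?N" using lfs by auto
    then show ?thesis unfolding balanced_def \<delta>_def \<alpha>_def by simp
  qed
  also have "\<dots> \<longleftrightarrow> br \<xi> \<eta> = 0"
  proof
    assume all: "\<forall>Xs. length Xs = Suc ?N \<longrightarrow> \<delta> Xs = 0"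
    let ?w = "br \<xi> \<eta>"
    have w\<eta>: "g ?w \<eta> = 0" using all \<delta>1 \<alpha>us lus by simp
    have wu: "g ?w u = 0" if u: "u \<in> set us" for u
    proof -
      let ?Z = "remove1 u us"
      have l: "Suc (length ?Z) = ?N" using u lus length_pos_if_in_set[OF u] by (simp add: length_remove1)
      have "set ?Z \<subseteq> set us" by (rule set_remove1_subset)
      then have o: "\<forall>z\<in>set ?Z. g z \<xi> = 0" using orth(1) by blast
      have "\<alpha> (?w # ?Z) = 0" using all \<delta>2[OF l o] l by simp
      have "linear (\<lambda>x. \<alpha> (x # ?Z))" by (rule alternating_form_linear_Cons[OF \<alpha> l])
      from expand[OF this br_orth]
      have "\<alpha> (?w # ?Z) = (\<Sum>h\<in>set us. g ?w h * \<alpha> (h # ?Z))" using w\<eta> by simp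
      also have "\<dots> = (\<Sum>h\<in>set us. if h = u then g ?w u * \<alpha> (u # ?Z) else 0)"
      proof (intro sum.cong refl)
        fix h assume h: "h \<in> set us"
        show "g ?w h * \<alpha> (h # ?Z) = (if h = u then g ?w u * \<alpha> (u # ?Z) else 0)"
        proof (cases "h = u")
          case False
          then have "\<not> distinct (h # ?Z)" using h by (simp add: in_set_remove1)
          then show ?thesis using alternating_form_not_distinct[OF \<alpha>, of "h # ?Z"] l False by simp
        qed simp
      qed
      also have "\<dots> = g ?w u * \<alpha> (u # ?Z)" using u by simp
      finally have "g ?w u * \<alpha> (u # ?Z) = 0" using \<open>\<alpha> (?w # ?Z) = 0\<close> by simp
      moreover have "\<bar>\<alpha> (u # ?Z)\<bar> = \<bar>\<alpha> us\<bar>"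
        by (rule alternating_form_abs_eq[OF \<alpha>]) (use u l in auto)
      ultimately show ?thesis using \<alpha>us by auto
    qed
    have "g ?w z = 0" for z
      using expand[OF linear_g_left[of z] br_orth, of \<xi> \<eta>] w\<eta> wu by simp
    then show "?w = 0" using g_eq_0_iff[of ?w] by blast
  next
    assume w: "br \<xi> \<eta> = 0"
    show "\<forall>Xs. length Xs = Suc ?N \<longrightarrow> \<delta> Xs = 0"
    proof (intro allI impI)
      fix Xs :: "'a list" assume "length Xs = Suc ?N"
      then show "\<delta> Xs = 0"
      proof (rule alternating_form_eq_0[OF \<delta> F(3)[unfolded S], rotated])
        fix ys assume ys: "set ys \<subseteq> insert \<xi> (insert \<eta> (set us))" "distinct ys" "length ys = Suc ?N"
        show "\<delta> ys = 0"
        proof (cases "\<xi> \<in> set ys")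
          case False
          then have "\<forall>y\<in>set ys. g y \<xi> = 0" using ys(1) orth(1) by auto
          then show ?thesis
            unfolding \<delta>_def using linear_0[OF alternating_form_linear_Cons[OF \<alpha>]] ys(3) by (intro ce_0) auto
        next
          case True
          let ?Y = "remove1 \<xi> ys"
          have lY: "length ?Y = ?N" using True ys(3) by (simp add: length_remove1)
          have sY: "set ?Y \<subseteq> insert \<eta> (set us)" using ys(1,2) by (auto simp: set_remove1_eq)
          have dY: "distinct ?Y" using ys(2) by (rule distinct_remove1)
          have 1: "\<bar>\<delta> ys\<bar> = \<bar>\<delta> (\<xi> # Zs)\<bar>" if "mset Zs = mset ?Y" for Zs
            by (rule alternating_form_abs_eq[OF \<delta>]) (use True ys(3) that in auto)
          show ?thesis
          proof (cases "\<eta> \<in> set ?Y")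
            case True
            let ?Z = "remove1 \<eta> ?Y"
            have l: "Suc (length ?Z) = ?N" using True lY length_pos_if_in_set[OF True] by (simp add: length_remove1)
            have "set ?Z \<subseteq> set us" using sY dY by (auto simp: set_remove1_eq)
            then have "\<forall>z\<in>set ?Z. g z \<xi> = 0" using orth(1) by blast
            from \<delta>2[OF l this] have "\<delta> (\<xi> # \<eta> # ?Z) = 0"
              using w linear_0[OF alternating_form_linear_Cons[OF \<alpha> l]] by simp
            moreover have "\<eta> \<in># mset ?Y" using True by (simp only: set_mset_mset)
            from insert_DiffM[OF this] have "mset (\<eta> # ?Z) = mset ?Y" by (simp only: mset.simps mset_remove1)
            ultimately show ?thesis using 1[of "\<eta> # ?Z"] by simp
          next
            case False
            then have "set ?Y \<subseteq> set us" using sY by blast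
            \<comment> \<open>The entries other than \<xi> are distinct elements of
              \<open>us\<close> and as many as \<open>us\<close> has, so they are a permutation of
              it.\<close>
            moreover have "card (set ?Y) = card (set us)" using distinct_card[OF dY] distinct_card[OF dus] lY lus by simp
            ultimately have "set us = set ?Y" using card_subset_eq[of "set us" "set ?Y"] by simp
            then have "mset us = mset ?Y" using dus dY set_eq_iff_mset_eq_distinct by blast
            then show ?thesis using 1[of us] \<delta>1 w by simp
          qed
        qed
      qed
    qed
  qed
  finally show ?thesis .
qed

section \<open>The holonomy criterion\<close>

text \<open>If \<open>br \<xi> \<eta>\<close> is nonzero, an explicit null-homotopic loop has a
  holonomy of determinant \<open>exp (\<i> * pi) = -1\<close>.\<close>

lemma holonomy_iff:
  fixes e :: "'n::finite \<Rightarrow> 'a"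
  assumes e: "unitary_frame J g e"
  shows "restricted_holonomy br (bismut br J g) \<subseteq> special_unitary J g e \<longleftrightarrow> br \<xi> \<eta> = 0"
proof
  assume "br \<xi> \<eta> = 0"
  then show "restricted_holonomy br (bismut br J g) \<subseteq> special_unitary J g e"
    by (intro restricted_holonomy_subset[OF e] connection_trace_br_eq_0[OF e])
next
  assume hol: "restricted_holonomy br (bismut br J g) \<subseteq> special_unitary J g e"
  show "br \<xi> \<eta> = 0"
  proof (rule ccontr)
    let ?\<tau> = "connection_trace e"
    assume "br \<xi> \<eta> \<noteq> 0"
    then have neg: "?\<tau> (br \<xi> \<eta>) < 0" by (rule connection_trace_br_neq_0[OF e])
    define r where "r = 60 * pi / ?\<tau> (br \<xi> \<eta>)"
    define Y where "Y = r *\<^sub>R \<eta>"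
    have \<tau>: "?\<tau> (br \<xi> Y) = 60 * pi"
      using neg by (simp add: Y_def linear_cmul[OF linear_connection_trace] r_def)
    \<comment> \<open>\<open>r\<close> is chosen such that \<open>\<integral> \<tau> (c) = - \<pi>\<close>, since \<open>\<integral> p' q = - 1 / 60\<close>.\<close>
    define p q p' q' :: "real \<Rightarrow> real"
      where "p = (\<lambda>t. t - t\<^sup>2)" and "q = (\<lambda>t. t\<^sup>2 - t ^ 3)" and "p' = (\<lambda>t. 1 - 2 * t)" and "q' = (\<lambda>t. 2 * t - 3 * t\<^sup>2)"
    have dp: "(p has_real_derivative p' t) (at t within S)" and dq: "(q has_real_derivative q' t) (at t within S)" for t S
      unfolding p_def q_def p'_def q'_def by (auto intro!: derivative_eq_intros)
    define c where "c = (\<lambda>t. p' t *\<^sub>R \<xi> + (p' t * q t) *\<^sub>R br \<xi> Y + q' t *\<^sub>R Y)"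
    have "br Y (br \<xi> Y) = 0"
      using br_eq[of Y "br \<xi> Y"] br_orth[of \<xi> Y] by (simp add: Y_def)
    then have loop: "null_homotopic_loop br c"
      unfolding c_def
      by (rule null_homotopic_loop_scaling[OF lie_bracket _ dp dq])
        (auto simp: p_def q_def p'_def q'_def intro!: continuous_intros)
    have "continuous_on {0..1} c"
      unfolding c_def p'_def q_def q'_def by (intro continuous_intros)
    then obtain F where F: "parallel_transport (bismut br J g) c F"
      by (rule parallel_transport_exists)
    \<comment> \<open>An explicit antiderivative of \<open>?\<tau> (c t)\<close>; the polynomial in
      the middle integrates \<open>p' t * q t\<close>. The outer terms vanish at both ends.\<close>
    define \<theta> where "\<theta> = (\<lambda>t. p t * ?\<tau> \<xi> + (t ^ 3 / 3 - 3 * t ^ 4 / 4 + 2 * t ^ 5 / 5) * ?\<tau> (br \<xi> Y) + q t * ?\<tau> Y)"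
    have "(\<theta> has_real_derivative ?\<tau> (c t)) (at t within {0..1})" for t
    proof -
      have "((\<lambda>t. t ^ 3 / 3 - 3 * t ^ 4 / 4 + 2 * t ^ 5 / 5) has_real_derivative p' t * q t) (at t within {0..1})"
        unfolding p'_def q_def
        by (auto intro!: derivative_eq_intros simp: field_simps eval_nat_numeral)
      moreover have "?\<tau> (c t) = p' t * ?\<tau> \<xi> + (p' t * q t) * ?\<tau> (br \<xi> Y) + q' t * ?\<tau> Y"
        by (simp add: c_def linear_add[OF linear_connection_trace] linear_cmul[OF linear_connection_trace])
      ultimately show ?thesis
        unfolding \<theta>_def by (simp only:) (intro DERIV_add DERIV_cmult_right dp dq)
    qed
    then have "(\<theta> has_vector_derivative ?\<tau> (c t)) (at t within {0..1})" for t
      by (simp add: has_real_derivative_iff_has_vector_derivative)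
    from parallel_transport_special_unitary_iff[OF F e this]
    have "F 1 \<in> special_unitary J g e \<longleftrightarrow> exp (\<i> * complex_of_real (\<theta> 0 - \<theta> 1)) = 1" .
    moreover have "\<theta> 0 - \<theta> 1 = pi" by (simp add: \<theta>_def p_def q_def \<tau>)
    moreover have "F 1 \<in> special_unitary J g e"
      using hol loop F unfolding restricted_holonomy_def by blast
    ultimately show False by (simp add: mult.commute)
  qed
qed

end

text \<open>The ideal is a hyperplane with normal \<open>a\<close> for the inner product of the type
  class; \<open>riesz\<close> converts \<open>a\<close> into a normal for \<open>g\<close>, which is
  then normalized.\<close>

lemma (in hermitian_lie_algebra) almost_abelian_unit_normal:
  assumes "almost_abelian br" and "unimodular br"
  obtains \<xi> where "almost_abelian_hermitian br J g \<xi>"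
proof -
  obtain H where H: "abelian_ideal br H" "dim H + 1 = DIM('a)"
    using assms(1) by (auto simp: almost_abelian_def)
  have sub: "subspace H" and ideal: "\<And>x y. y \<in> H \<Longrightarrow> br x y \<in> H" and ab: "\<And>x y. x \<in> H \<Longrightarrow> y \<in> H \<Longrightarrow> br x y = 0"
    using H(1) by (auto simp: abelian_ideal_def)
  have "dim H = DIM('a) - 1" using H(2) by simp
  then obtain a where a: "a \<noteq> 0" "span H = {x. a \<bullet> x = 0}" using dim_eq_hyperplane[of H] by blast
  have "linear (\<lambda>z. a \<bullet> z)" by (rule linearI) (simp_all add: inner_add_right)
  from riesz[OF this] obtain w where w: "\<And>z. g w z = a \<bullet> z" by blast
  have "a \<bullet> a \<noteq> 0" using a(1) by simp
  then have "w \<noteq> 0" using w[of a] by (auto simp del: inner_eq_zero_iff)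
  then have ww: "g w w > 0" using inner_product_g by (auto simp: inner_product_def)
  define \<xi> where "\<xi> = (1 / sqrt (g w w)) *\<^sub>R w"
  have unit: "g \<xi> \<xi> = 1" using ww \<open>w \<noteq> 0\<close> by (simp add: \<xi>_def)
  have mem: "x \<in> H \<longleftrightarrow> g x \<xi> = 0" for x
  proof -
    have "g x \<xi> = 0 \<longleftrightarrow> a \<bullet> x = 0" using ww \<open>w \<noteq> 0\<close> g_sym[of x w] w[of x] by (simp add: \<xi>_def)
    moreover have "x \<in> H \<longleftrightarrow> a \<bullet> x = 0"
      using a(2) sub by (subst span_eq_iff[THEN iffD2, OF sub, symmetric]) simp
    ultimately show ?thesis by simp
  qed
  have split: "\<exists>h. h \<in> H \<and> x = g x \<xi> *\<^sub>R \<xi> + h" for x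
    using unit by (intro exI[of _ "x - g x \<xi> *\<^sub>R \<xi>"]) (simp add: mem)
  have "br x y = g x \<xi> *\<^sub>R br \<xi> y - g y \<xi> *\<^sub>R br \<xi> x" for x y
  proof -
    obtain h k where h: "h \<in> H" "x = g x \<xi> *\<^sub>R \<xi> + h" and k: "k \<in> H" "y = g y \<xi> *\<^sub>R \<xi> + k" using split by metis
    have 1: "br \<xi> x = br \<xi> h" "br \<xi> y = br \<xi> k"
      by (subst h(2), simp, subst k(2), simp)
    have "br x y = br (g x \<xi> *\<^sub>R \<xi> + h) (g y \<xi> *\<^sub>R \<xi> + k)" using h(2) k(2) by simp
    also have "\<dots> = g x \<xi> *\<^sub>R br \<xi> k + g y \<xi> *\<^sub>R br h \<xi>" using ab[OF h(1) k(1)] by simp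
    also have "br h \<xi> = - br \<xi> h" by (rule br_antisym)
    finally show ?thesis using 1 by simp
  qed
  moreover have "g (br x y) \<xi> = 0" for x y
  proof -
    obtain h where h: "h \<in> H" "x = g x \<xi> *\<^sub>R \<xi> + h" using split by blast
    obtain k where k: "k \<in> H" "y = g y \<xi> *\<^sub>R \<xi> + k" using split by blast
    have "br \<xi> y = br \<xi> k" "br \<xi> x = br \<xi> h" by (subst k(2), simp, subst h(2), simp)
    then have "g (br \<xi> y) \<xi> = 0" "g (br \<xi> x) \<xi> = 0" using ideal[OF k(1), of \<xi>] ideal[OF h(1), of \<xi>] mem by simp_all
    then show ?thesis unfolding \<open>\<And>x y. br x y = _\<close>[of x y] by simp
  qed
  ultimately have "almost_abelian_hermitian br J g \<xi>"
    using assms(2) unit by unfold_locales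
  then show ?thesis by (rule that)
qed

theorem proposition3p3:
  fixes br :: "'a::euclidean_space \<Rightarrow> 'a \<Rightarrow> 'a"
    and J :: "'a \<Rightarrow> 'a"
    and g :: "'a \<Rightarrow> 'a \<Rightarrow> real"
  assumes "lie_bracket br" and "almost_abelian br" and "unimodular br"
    and "DIM('a) = 2 * CARD('n::finite)"
    and "hermitian_structure br J g"
  shows "(\<exists>e :: 'n \<Rightarrow> 'a. unitary_frame J g e \<and>
            restricted_holonomy br (bismut br J g) \<subseteq> special_unitary J g e)
         \<longleftrightarrow> balanced CARD('n) br J g"
proof -
  interpret hermitian_lie_algebra br J g
    using assms by unfold_locales
  obtain \<xi> where "almost_abelian_hermitian br J g \<xi>"
    using almost_abelian_unit_normal[OF assms(2,3)] .
  then interpret almost_abelian_hermitian br J g \<xi> .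
  \<comment> \<open>The criterion \<open>br \<xi> \<eta> = 0\<close> is the same for all frames, so
    a single frame decides the existential statement.\<close>
  obtain e :: "'n \<Rightarrow> 'a" where "unitary_frame J g e"
    using unitary_frame_exists[OF assms(4)] .
  then show ?thesis
    using holonomy_iff balanced_iff[OF assms(4)] by blast
qed

end
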